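(* Two agents executing Algorithm PTLandmarkWithChirality (defined in the context) in the semi-synchronous Passive Transport (PT) model with chirality (and no known bound on the ring size) will explore a (1-interval connected) ring with a landmark using at most $O(n^2)$ edge traversals, where $n$ is the ring size. Furthermore, one agent explicitly terminates, while the other either terminates or waits perpetually on a port.
   Context: Ring: the nodes $v_0,\dots,v_{n-1}$ (indices modulo $n$) form a cycle; $v_i$ is linked to $v_{i-1}$ and $v_{i+1}$ via distinctly labelled ports $q_{i-}$ and $q_{i+}$ (labels need not be globally consistent). Time proceeds in rounds; in each round at most one edge, chosen by an adversary, is missing (1-interval connected ring). Landmark: one node is different from all others, and an agent performing Look at a node sees whether that node is the landmark. Agents: each has memory and computational power; they are anonymous (no identifiers) and all execute the same protocol. They start at arbitrary, not necessarily distinct, nodes, cannot communicate explicitly and cannot mark nodes. Each agent $a_j$ has a consistent private orientation, i.e. a function $\lambda_j$ designating each port left or right with $\lambda_j(q_{i-})=\lambda_j(q_{k-})$ for all $i,k$. Chirality: all agents have the same orientation and are aware of it. Round: each active agent performs Look (it sees its own position within its node, i.e. whether it is on a port and which one, and the positions of the other agents at that node), Compute (from this snapshot and its memory it determines a direction in $\{left,right,nil\}$; if $nil$ it becomes inactive; otherwise it tries to access the corresponding port if not already there), and Move. Ports are accessed in mutual exclusion: an occupied port cannot be gained, and if several agents try the same port exactly one succeeds; an agent that fails sets $moved=false$ and becomes inactive. An agent on a port after computing moves to the other endpoint if the edge is present in this round (setting $moved=true$), and otherwise stays on the port (setting $moved=false$); in either case the port is denied to other agents in that round. Two agents crossing the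 same edge in opposite directions in the same round might not detect each other. Semi-synchronous ($\mathcal{SSYNC}$): in each round an adversary activates a non-empty subset of the agents, the others being asleep (passive); every agent is activated infinitely often; an activated agent does not know whether it was active in the previous round. An agent may be asleep on a port. PT model: if an agent is sleeping on a port in round $t$ and the corresponding edge is present in round $t$, the agent is moved to the other endpoint of the edge in round $t$. Exploration is solved if within finite time every node is visited by at least one agent. An agent explicitly terminates if within finite time it enters a terminal state and no longer moves; a terminal state may be entered only after the ring has been explored. The cost is the total number of edge traversals by the agents. Procedure Explore($dir$ | $p_1:s_1$; ...; $p_k:s_k$), with $dir\in\{left,right\}$, predicates $p_i$ and states $s_i$: the agent performs Look, then evaluates $p_1,\dots,p_k$ in order; as soon as some $p_i$ is satisfied the procedure exits and the agent makes a transition to state $s_i$. If no predicate is satisfied, the agent tries to move in direction $dir$ and the procedure is executed again in the next round (in which the agent is active). Variables and predicates of an agent: $Esteps$ is the number of successful moves since Explore was last called (an assignment made on entering a state, before a new call, uses the value of the call just exited); $Btime$ is the number of consecutive rounds the agent has currently been waiting in a port. "catches": the agent is in the node and the other agent is observed on a port in the moving direction of the first agent. "$n$ is known": the agent has performed a complete loop around the ring, detected by means of the landmark (it tracks its distance from the landmark since first encountering it), and thus knows $n$. Algorithm PTLandmarkWithChirality (each agent starts in state Init with $leftSteps\gets\bot$, $rightSteps\gets\bot$; Terminate is the terminal state): - State Init: Explore(left | $n$ is known: Terminate; catches: Bounce). - State Bounce: $leftSteps\gets Esteps$; if $rightSteps\ne\bot$ and $rightSteps\ge leftSteps$, Terminate;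 otherwise Explore(right | $n$ is known: Terminate; $Btime>0$: Reverse). - State Reverse: $rightSteps\gets Esteps$; Explore(left | $n$ is known: Terminate; catches: Bounce). *)

theory Defs
  imports Complex_Main "HOL-Library.Landau_Symbols"
begin

text \<open>The nodes of the ring of size \<open>n\<close> are \<open>0, \<dots>, n - 1\<close>. The port \<open>q\<^sub>i\<^sub>-\<close> of node \<open>i\<close> is \<open>(i, Minus)\<close>
  and leads to node \<open>i - 1\<close>; the port \<open>q\<^sub>i\<^sub>+\<close> is \<open>(i, Plus)\<close> and leads to node \<open>i + 1\<close> (modulo \<open>n\<close>).
  The edge between \<open>i\<close> and \<open>i + 1\<close> has number \<open>i\<close>.\<close>

datatype side = Minus | Plus

type_synonym port = "nat \<times> side"

fun neighbour :: "nat \<Rightarrow> port \<Rightarrow> nat" where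
  "neighbour n (i, Minus) = (i + n - 1) mod n"
| "neighbour n (i, Plus) = (i + 1) mod n"

fun edge_of :: "nat \<Rightarrow> port \<Rightarrow> nat" where
  "edge_of n (i, Minus) = (i + n - 1) mod n"
| "edge_of n (i, Plus) = i"

datatype direction = Left | Right

text \<open>A private orientation designates one port of each node as left and the other one as right,
  consistently along the ring.\<close>

type_synonym orientation = "port \<Rightarrow> direction"

definition consistent_orientation :: "nat \<Rightarrow> orientation \<Rightarrow> bool" where
  "consistent_orientation n lam \<longleftrightarrow>
     (\<forall>i<n. lam (i, Minus) \<noteq> lam (i, Plus)) \<and>
     (\<forall>i<n. \<forall>k<n. \<forall>s. lam (i, s) = lam (k, s))"

definition side_of :: "orientation \<Rightarrow> nat \<Rightarrow> direction \<Rightarrow> side" where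
  "side_of lam i d = (if lam (i, Minus) = d then Minus else Plus)"

text \<open>The position of an agent within its node: properly inside the node, or on one of the ports.
  Ports are sides from the global point of view and directions from that of an agent.\<close>

datatype 'p place = Inside | OnPort 'p

datatype control = Init | Bounce | Reverse | Terminate

text \<open>The undefined value of a variable is \<open>None\<close>. The field \<open>dist\<close> is the signed distance from the
  landmark, counted positively to the right, and is \<open>None\<close> until the landmark is first encountered;
  \<open>ring_size\<close> is the size of the ring once the agent knows it.\<close>

record memory =
  control :: control
  leftSteps :: "nat option"
  rightSteps :: "nat option"
  Esteps :: nat
  Btime :: nat
  dist :: "int option"
  ring_size :: "nat option"

definition init_memory :: memory where
  "init_memory = \<lparr>control = Init, leftSteps = None, rightSteps = None, Esteps = 0, Btime = 0,
     dist = None, ring_size = None\<rparr>"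

text \<open>What an agent sees during Look: its own position, the position of the other agent if that agent
  is at the same node, and whether the node is the landmark.\<close>

record snapshot =
  own_place :: "direction place"
  other_place :: "direction place option"
  at_landmark :: bool

text \<open>Tracking of the landmark: being at the landmark at nonzero distance from its first encounter
  means that the agent has made a complete loop, of length equal to that distance.\<close>

definition observe_landmark :: "snapshot \<Rightarrow> memory \<Rightarrow> memory" where
  "observe_landmark s m =
     (if at_landmark s then
        (case dist m of
           None \<Rightarrow> m\<lparr>dist := Some 0\<rparr>
         | Some d \<Rightarrow> if d = 0 then m else m\<lparr>ring_size := Some (nat \<bar>d\<bar>)\<rparr>)
      else m)"

definition n_known :: "memory \<Rightarrow> bool" where
  "n_known m \<longleftrightarrow> ring_size m \<noteq> None"

definition catches :: "direction \<Rightarrow> snapshot \<Rightarrow> bool" where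
  "catches d s \<longleftrightarrow> own_place s = Inside \<and> other_place s = Some (OnPort d)"

fun explore_direction :: "control \<Rightarrow> direction option" where
  "explore_direction Init = Some Left"
| "explore_direction Bounce = Some Right"
| "explore_direction Reverse = Some Left"
| "explore_direction Terminate = None"

fun explore_exit :: "control \<Rightarrow> snapshot \<Rightarrow> memory \<Rightarrow> control option" where
  "explore_exit Init s m =
     (if n_known m then Some Terminate else if catches Left s then Some Bounce else None)"
| "explore_exit Bounce s m =
     (if n_known m then Some Terminate else if Btime m > 0 then Some Reverse else None)"
| "explore_exit Reverse s m =
     (if n_known m then Some Terminate else if catches Left s then Some Bounce else None)"
| "explore_exit Terminate s m = None"

fun enter_state :: "control \<Rightarrow> memory \<Rightarrow> memory" where
  "enter_state Init m = m\<lparr>control := Init, leftSteps := None, rightSteps := None, Esteps := 0\<rparr>"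
| "enter_state Bounce m =
     (let m' = m\<lparr>leftSteps := Some (Esteps m)\<rparr> in
      if (\<exists>r. rightSteps m' = Some r \<and> r \<ge> Esteps m)
      then m'\<lparr>control := Terminate\<rparr>
      else m'\<lparr>control := Bounce, Esteps := 0\<rparr>)"
| "enter_state Reverse m =
     m\<lparr>control := Reverse, rightSteps := Some (Esteps m), Esteps := 0\<rparr>"
| "enter_state Terminate m = m\<lparr>control := Terminate\<rparr>"

text \<open>A state that is entered calls Explore in the same round, with the same snapshot. This recursion
  stops, since \<open>Btime > 0\<close> means being on a port whereas an agent that catches is inside its node.\<close>

partial_function (tailrec) run_explore :: "snapshot \<Rightarrow> memory \<Rightarrow> memory \<times> direction option" where
  "run_explore s m =
     (case explore_exit (control m) s m of
        None \<Rightarrow> (m, explore_direction (control m))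
      | Some st \<Rightarrow> run_explore s (enter_state st m))"

definition compute :: "snapshot \<Rightarrow> memory \<Rightarrow> memory \<times> direction option" where
  "compute s m = run_explore s (observe_landmark s m)"

datatype agent = A | B

fun other_agent :: "agent \<Rightarrow> agent" where
  "other_agent A = B"
| "other_agent B = A"

text \<open>The agents have no identifiers of their own: \<open>A\<close> and \<open>B\<close> only name them from the outside, and
  the protocol does not depend on them.\<close>

record config =
  node :: "agent \<Rightarrow> nat"
  place :: "agent \<Rightarrow> side place"
  mem :: "agent \<Rightarrow> memory"

text \<open>The adversary chooses the agents that are active, the edge that is missing (if any), and the
  agent that succeeds if both try to gain the same port.\<close>

record choice =
  active :: "agent set"
  missing :: "nat option"
  winner :: agent

definition look :: "nat \<Rightarrow> (agent \<Rightarrow> orientation) \<Rightarrow> config \<Rightarrow> agent \<Rightarrow> snapshot" where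
  "look landmark lam c j =
     (let i = node c j; view = map_place (\<lambda>s. lam j (i, s)) in
      \<lparr>own_place = view (place c j),
       other_place =
         (if node c (other_agent j) = i then Some (view (place c (other_agent j))) else None),
       at_landmark = (i = landmark)\<rparr>)"

definition decision ::
  "nat \<Rightarrow> (agent \<Rightarrow> orientation) \<Rightarrow> config \<Rightarrow> agent \<Rightarrow> memory \<times> direction option" where
  "decision landmark lam c j = compute (look landmark lam c j) (mem c j)"

definition wanted_side ::
  "nat \<Rightarrow> (agent \<Rightarrow> orientation) \<Rightarrow> config \<Rightarrow> agent \<Rightarrow> side option" where
  "wanted_side landmark lam c j =
     map_option (side_of (lam j) (node c j)) (snd (decision landmark lam c j))"

definition gains_access ::
  "nat \<Rightarrow> (agent \<Rightarrow> orientation) \<Rightarrow> choice \<Rightarrow> config \<Rightarrow> agent \<Rightarrow> side \<Rightarrow> bool" where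
  "gains_access landmark lam ch c j s \<longleftrightarrow>
     (let k = other_agent j; together = (node c k = node c j) in
      place c j = OnPort s \<or>
      \<not> (together \<and> place c k = OnPort s) \<and>
      \<not> (together \<and> k \<in> active ch \<and> wanted_side landmark lam c k = Some s \<and> winner ch = k))"

text \<open>The effect of an edge traversal, and of waiting on a port, on the counters of an agent. An agent
  that is transported while asleep finds itself off its port at the next Look, hence it accounts for
  passive moves as well.\<close>

definition count_move :: "direction \<Rightarrow> memory \<Rightarrow> memory" where
  "count_move d m =
     m\<lparr>Esteps := Esteps m + 1, Btime := 0,
       dist := map_option (\<lambda>x. case d of Left \<Rightarrow> x - 1 | Right \<Rightarrow> x + 1) (dist m)\<rparr>"

definition count_wait :: "memory \<Rightarrow> memory" where
  "count_wait m = m\<lparr>Btime := Btime m + 1\<rparr>"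

text \<open>Crossing of the edge behind port \<open>s\<close> of node \<open>i\<close>, by an active agent or by passive transport.\<close>

definition cross ::
  "nat \<Rightarrow> orientation \<Rightarrow> choice \<Rightarrow> nat \<Rightarrow> side \<Rightarrow> memory \<Rightarrow> nat \<times> side place \<times> memory" where
  "cross n lam ch i s m =
     (if missing ch = Some (edge_of n (i, s))
      then (i, OnPort s, count_wait m)
      else (neighbour n (i, s), Inside, count_move (lam (i, s)) m))"

text \<open>An agent that fails to gain a port is inside its node afterwards: if it was on the opposite port,
  it has left it.\<close>

definition agent_step ::
  "nat \<Rightarrow> nat \<Rightarrow> (agent \<Rightarrow> orientation) \<Rightarrow> choice \<Rightarrow> config \<Rightarrow> agent \<Rightarrow> nat \<times> side place \<times> memory"
where
  "agent_step n landmark lam ch c j =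
     (let i = node c j in
      if j \<in> active ch then
        (let m = fst (decision landmark lam c j) in
         case wanted_side landmark lam c j of
           None \<Rightarrow> (i, place c j, m)
         | Some s \<Rightarrow>
             if gains_access landmark lam ch c j s then cross n (lam j) ch i s m
             else (i, Inside, m\<lparr>Btime := 0\<rparr>))
      else
        (case place c j of
           Inside \<Rightarrow> (i, Inside, mem c j)
         | OnPort s \<Rightarrow> cross n (lam j) ch i s (mem c j)))"

definition round_step ::
  "nat \<Rightarrow> nat \<Rightarrow> (agent \<Rightarrow> orientation) \<Rightarrow> choice \<Rightarrow> config \<Rightarrow> config" where
  "round_step n landmark lam ch c =
     \<lparr>node = (\<lambda>j. fst (agent_step n landmark lam ch c j)),
      place = (\<lambda>j. fst (snd (agent_step n landmark lam ch c j))),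
      mem = (\<lambda>j. snd (snd (agent_step n landmark lam ch c j)))\<rparr>"

definition initial_config :: "nat \<Rightarrow> config \<Rightarrow> bool" where
  "initial_config n c \<longleftrightarrow>
     (\<forall>j. node c j < n \<and> place c j = Inside \<and> mem c j = init_memory)"

definition semi_synchronous :: "(nat \<Rightarrow> choice) \<Rightarrow> bool" where
  "semi_synchronous ch \<longleftrightarrow>
     (\<forall>t. active (ch t) \<noteq> {}) \<and> (\<forall>j. \<exists>\<^sub>\<infinity>t. j \<in> active (ch t))"

definition one_interval_connected :: "nat \<Rightarrow> (nat \<Rightarrow> choice) \<Rightarrow> bool" where
  "one_interval_connected n ch \<longleftrightarrow> (\<forall>t e. missing (ch t) = Some e \<longrightarrow> e < n)"

text \<open>\<open>c t\<close> is the configuration at the beginning of round \<open>t\<close>.\<close>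

definition execution ::
  "nat \<Rightarrow> nat \<Rightarrow> (agent \<Rightarrow> orientation) \<Rightarrow> (nat \<Rightarrow> choice) \<Rightarrow> (nat \<Rightarrow> config) \<Rightarrow> bool" where
  "execution n landmark lam ch c \<longleftrightarrow>
     n \<ge> 3 \<and> landmark < n \<and>
     (\<forall>j. consistent_orientation n (lam j)) \<and>
     semi_synchronous ch \<and> one_interval_connected n ch \<and>
     initial_config n (c 0) \<and>
     (\<forall>t. c (Suc t) = round_step n landmark lam (ch t) (c t))"

definition chirality :: "nat \<Rightarrow> (agent \<Rightarrow> orientation) \<Rightarrow> bool" where
  "chirality n lam \<longleftrightarrow> (\<forall>j k. \<forall>i<n. \<forall>s. lam j (i, s) = lam k (i, s))"

definition explored_by :: "nat \<Rightarrow> (nat \<Rightarrow> config) \<Rightarrow> nat \<Rightarrow> bool" where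
  "explored_by n c T \<longleftrightarrow> (\<forall>i<n. \<exists>t\<le>T. \<exists>j. node (c t) j = i)"

text \<open>Number of edge traversals in the first \<open>T\<close> rounds. Since a ring has no loops, an agent traverses
  an edge in a round exactly if its node changes.\<close>

definition traversals :: "(nat \<Rightarrow> config) \<Rightarrow> nat \<Rightarrow> nat" where
  "traversals c T =
     card {t. t < T \<and> node (c (Suc t)) A \<noteq> node (c t) A} +
     card {t. t < T \<and> node (c (Suc t)) B \<noteq> node (c t) B}"

definition terminal :: "config \<Rightarrow> agent \<Rightarrow> bool" where
  "terminal c j \<longleftrightarrow> control (mem c j) = Terminate"

definition terminates :: "(nat \<Rightarrow> config) \<Rightarrow> agent \<Rightarrow> bool" where
  "terminates c j \<longleftrightarrow>
     (\<exists>T. \<forall>t\<ge>T. terminal (c t) j \<and> node (c t) j = node (c T) j)"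

definition waits_forever_on_port :: "(nat \<Rightarrow> config) \<Rightarrow> agent \<Rightarrow> bool" where
  "waits_forever_on_port c j \<longleftrightarrow>
     (\<exists>T i s. \<forall>t\<ge>T. node (c t) j = i \<and> place (c t) j = OnPort s)"

end

theory Submission
  imports Defs "HOL-Library.Infinite_Set"
begin

text \<open>Lift the walks of the two agents to the integers.

  Cost: an agent that has not terminated stays within distance \<open>n\<close> of the point where it first met the
  landmark, and each of its excursions (right from a catch, then left until the next catch) ends strictly
  further left than it began, for otherwise it would have terminated. So each agent makes \<open>O(n)\<close>
  excursions of length \<open>O(n)\<close>.

  Safety: suppose that the agent \<open>a\<close>, having caught \<open>b\<close> at \<open>x\<close>, goes right, is blocked, turns round and
  catches \<open>b\<close> again at some point not left of \<open>x\<close>. While \<open>a\<close> was blocked, \<open>b\<close> cannot have waited on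
  the left port at \<open>x\<close>, unless both waited at the same edge, with the whole ring between them. Hence \<open>b\<close>
  has moved strictly left of \<open>x\<close>, so when the two meet again their lifts differ by a positive
  multiple of \<open>n\<close>, and together they have seen every node.

  Liveness: since moves are bounded, both agents eventually stand still, and without moves an agent
  changes state only finitely often. If none has terminated, both are then blocked forever
  on left ports; only one edge is missing at a time, so they are at the same port, which is impossible.\<close>

section \<open>Auxiliary facts and the outcomes of a single Compute\<close>

lemma nat_antimono_stable:
  fixes f :: "nat \<Rightarrow> nat"
  assumes "\<And>t. t \<ge> T0 \<Longrightarrow> f (Suc t) \<le> f t"
  shows "\<exists>T\<ge>T0. \<forall>t\<ge>T. f (Suc t) = f t"
proof -
  obtain T where T: "T \<ge> T0" "\<And>t. t \<ge> T0 \<Longrightarrow> f T \<le> f t"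
    using ex_has_least_nat[of "\<lambda>t. t \<ge> T0" T0 f] by auto
  have "f t = f T" if "t \<ge> T" for t
    using that
  proof (induction t rule: dec_induct)
    case (step t)
    then show ?case using assms[of t] T(2)[of "Suc t"] T(1) by simp
  qed simp
  then show ?thesis using T(1) le_SucI by metis
qed

lemma other_agent_simps [simp]:
  "other_agent (other_agent j) = j" "other_agent j \<noteq> j" "j \<noteq> other_agent j"
  by (cases j; simp)+

lemma agent_eq_or_other: "(k :: agent) = j \<or> k = other_agent j"
  by (cases j; cases k; simp)

lemma observe_landmark_simps [simp]:
  "control (observe_landmark s m) = control m"
  "Esteps (observe_landmark s m) = Esteps m"
  "Btime (observe_landmark s m) = Btime m"
  "rightSteps (observe_landmark s m) = rightSteps m"
  by (auto simp: observe_landmark_def split: option.splits)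

lemma run_explore_None:
  "explore_exit (control m) s m = None \<Longrightarrow> run_explore s m = (m, explore_direction (control m))"
  by (simp add: run_explore.simps[of s m])

lemma run_explore_Some:
  "explore_exit (control m) s m = Some st \<Longrightarrow> run_explore s m = run_explore s (enter_state st m)"
  by (simp add: run_explore.simps[of s m])

text \<open>The premise on \<open>Btime\<close> makes at most one state change happen per Compute.
  An agent that catches is inside, so its \<open>Btime\<close> is 0 and it cannot reverse in the
  same round; an agent that reverses is not inside, so it cannot catch in the same round.\<close>

lemma compute_cases:
  assumes "control m \<noteq> Terminate" "own_place s = Inside \<Longrightarrow> Btime m = 0"
  defines "m1 \<equiv> observe_landmark s m"
  obtains
    (known) "n_known m1" "compute s m = (m1\<lparr>control := Terminate\<rparr>, None)"
  | (keep) "\<not> n_known m1" "compute s m = (m1, explore_direction (control m))"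
      "control m = Bounce \<Longrightarrow> Btime m = 0" "control m \<noteq> Bounce \<Longrightarrow> \<not> catches Left s"
  | (stop) r where "\<not> n_known m1" "catches Left s" "control m = Init \<or> control m = Reverse"
      "rightSteps m = Some r" "Esteps m \<le> r"
      "compute s m = (m1\<lparr>leftSteps := Some (Esteps m), control := Terminate\<rparr>, None)"
  | (bounce) "\<not> n_known m1" "catches Left s" "control m = Init \<or> control m = Reverse"
      "\<And>r. rightSteps m = Some r \<Longrightarrow> r < Esteps m"
      "compute s m =
        (m1\<lparr>leftSteps := Some (Esteps m), control := Bounce, Esteps := 0\<rparr>, Some Right)"
  | (reverse) "\<not> n_known m1" "control m = Bounce" "Btime m > 0"
      "compute s m =
        (m1\<lparr>control := Reverse, rightSteps := Some (Esteps m), Esteps := 0\<rparr>, Some Left)"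
proof -
  note [simp] = run_explore_None run_explore_Some n_known_def Let_def
  have m1: "control m1 = control m" "Esteps m1 = Esteps m" "Btime m1 = Btime m"
    "rightSteps m1 = rightSteps m"
    by (simp_all add: m1_def)
  have c: "compute s m = run_explore s m1" by (simp add: compute_def m1_def)
  show thesis
  proof (cases "n_known m1")
    case True
    then have "compute s m = (m1\<lparr>control := Terminate\<rparr>, None)"
      using assms(1) c m1 by (cases "control m") auto
    with True show ?thesis by (rule known)
  next
    case F: False
    show ?thesis
    proof (cases "control m = Bounce")
      case True
      have "Btime m > 0 \<Longrightarrow> \<not> catches Left s"
        using assms(2) by (auto simp: catches_def)
      with True have "compute s m = (if Btime m > 0
        then (m1\<lparr>control := Reverse, rightSteps := Some (Esteps m), Esteps := 0\<rparr>, Some Left)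
        else (m1, Some Right))"
        using c m1 F by auto
      then show ?thesis using True F reverse keep by (cases "Btime m > 0") auto
    next
      case False
      then have ctl: "control m = Init \<or> control m = Reverse"
        using assms(1) by (cases "control m") auto
      show ?thesis
      proof (cases "catches Left s")
        case True
        then have bt: "Btime m = 0" using assms(2) by (simp add: catches_def)
        show ?thesis
        proof (cases "\<exists>r. rightSteps m = Some r \<and> Esteps m \<le> r")
          case T: True
          then obtain r where r: "rightSteps m = Some r" "Esteps m \<le> r" by blast
          have "compute s m = (m1\<lparr>leftSteps := Some (Esteps m), control := Terminate\<rparr>, None)"
            using ctl c m1 F True r by auto
          then show ?thesis using stop F True ctl r by blast
        next
          case G: False
          have "compute s m =
            (m1\<lparr>leftSteps := Some (Esteps m), control := Bounce, Esteps := 0\<rparr>, Some Right)"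
            using ctl c m1 F True G bt by auto
          then show ?thesis using bounce F True ctl G by (meson leI)
        qed
      next
        case G: False
        have "compute s m = (m1, explore_direction (control m))"
          using ctl c m1 F G by auto
        then show ?thesis using keep F G False by blast
      qed
    qed
  qed
qed

section \<open>Global directions and the outcome of one round\<close>

locale ring_execution =
  fixes n landmark :: nat and lam :: "agent \<Rightarrow> orientation" and ch :: "nat \<Rightarrow> choice"
    and c :: "nat \<Rightarrow> config"
  assumes exec: "execution n landmark lam ch c" and chir: "chirality n lam"
begin

lemma n_ge_3: "n \<ge> 3" and landmark_less: "landmark < n"
  and semi_sync: "semi_synchronous ch"
  and initial: "node (c 0) j < n" "place (c 0) j = Inside" "mem (c 0) j = init_memory"
  and step: "c (Suc t) = round_step n landmark lam (ch t) (c t)"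
  using exec unfolding execution_def initial_config_def by simp_all

text \<open>By chirality and consistency all orientations agree on the ring with that of
  \<open>A\<close> at node 0, so one translation between sides and directions serves both agents and
  all nodes.\<close>

definition dir_of :: "side \<Rightarrow> direction" where
  "dir_of s = lam A (0, s)"

definition port_side :: "direction \<Rightarrow> side" where
  "port_side d = (if dir_of Minus = d then Minus else Plus)"

lemma lam_eq_dir_of:
  assumes "i < n" shows "lam j (i, s) = dir_of s"
proof -
  have "lam j (i, s) = lam A (i, s)"
    using chir assms unfolding chirality_def by blast
  also have "\<dots> = dir_of s"
    using exec assms n_ge_3 unfolding execution_def consistent_orientation_def dir_of_def
    by (metis gr0I not_numeral_le_zero)
  finally show ?thesis .
qed

lemma dir_of_neq: "dir_of Minus \<noteq> dir_of Plus"
  using exec n_ge_3 unfolding execution_def consistent_orientation_def dir_of_def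
  by (metis gr0I not_numeral_le_zero)

lemma dir_of_port_side [simp]: "dir_of (port_side d) = d"
  using dir_of_neq by (simp add: port_side_def) (metis direction.exhaust)

lemma port_side_dir_of [simp]: "port_side (dir_of s) = s"
  using dir_of_neq by (cases s) (auto simp: port_side_def)

lemma port_side_eq_iff [simp]: "port_side d = port_side e \<longleftrightarrow> d = e"
  by (metis dir_of_port_side)

lemma side_of_port_side: "i < n \<Longrightarrow> side_of (lam j) i d = port_side d"
  by (simp add: port_side_def side_of_def lam_eq_dir_of)

lemma lam_port_side: "i < n \<Longrightarrow> lam j (i, port_side d) = d"
  by (simp add: lam_eq_dir_of)

lemma port_side_lam: "i < n \<Longrightarrow> port_side (lam j (i, s)) = s"
  by (simp add: lam_eq_dir_of)

definition at_port :: "nat \<Rightarrow> agent \<Rightarrow> direction \<Rightarrow> bool" where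
  "at_port t j d \<longleftrightarrow> place (c t) j = OnPort (port_side d)"

definition inside :: "nat \<Rightarrow> agent \<Rightarrow> bool" where
  "inside t j \<longleftrightarrow> place (c t) j = Inside"

definition blocked :: "nat \<Rightarrow> agent \<Rightarrow> direction \<Rightarrow> bool" where
  "blocked t j d \<longleftrightarrow> missing (ch t) = Some (edge_of n (node (c t) j, port_side d))"

definition towards :: "nat \<Rightarrow> direction \<Rightarrow> nat" where
  "towards i d = neighbour n (i, port_side d)"

definition caught :: "nat \<Rightarrow> agent \<Rightarrow> bool" where
  "caught t j \<longleftrightarrow> inside t j \<and> node (c t) (other_agent j) = node (c t) j \<and>
     at_port t (other_agent j) Left"

text \<open>An agent asleep on a port is treated as one that decides to use this port: passive transport
  has the same effect.\<close>

definition plan :: "nat \<Rightarrow> agent \<Rightarrow> memory \<times> direction option" where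
  "plan t j =
     (if j \<in> active (ch t) then decision landmark lam (c t) j
      else (mem (c t) j, case place (c t) j of Inside \<Rightarrow> None
                         | OnPort s \<Rightarrow> Some (lam j (node (c t) j, s))))"

lemma place_cases:
  assumes "node (c t) j < n"
  obtains "inside t j" "\<not> at_port t j Left" "\<not> at_port t j Right"
  | d where "at_port t j d" "\<not> inside t j" "\<And>e. at_port t j e \<longleftrightarrow> e = d"
proof (cases "place (c t) j")
  case Inside
  then show ?thesis using that(1) by (simp add: inside_def at_port_def)
next
  case (OnPort s)
  then have "place (c t) j = OnPort (port_side (lam j (node (c t) j, s)))"
    using port_side_lam[OF assms] by simp
  then show ?thesis using that(2)[of "lam j (node (c t) j, s)"]
    by (simp add: inside_def at_port_def) (metis)
qed

lemma plan_None:
  assumes "plan t j = (m, None)"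
  shows "node (c (Suc t)) j = node (c t) j" "place (c (Suc t)) j = place (c t) j"
    "mem (c (Suc t)) j = m"
  using assms
  by (auto simp: plan_def step round_step_def agent_step_def wanted_side_def
      split: if_splits place.splits)

lemma plan_Some:
  assumes "plan t j = (m, Some d)" "node (c t) j < n"
  obtains
    (move) "\<not> blocked t j d" "node (c (Suc t)) j = towards (node (c t) j) d" "inside (Suc t) j"
      "mem (c (Suc t)) j = count_move d m"
  | (wait) "blocked t j d" "node (c (Suc t)) j = node (c t) j" "at_port (Suc t) j d"
      "mem (c (Suc t)) j = count_wait m"
      "j \<in> active (ch t) \<longrightarrow> gains_access landmark lam (ch t) (c t) j (port_side d)"
  | (fail) "j \<in> active (ch t)" "\<not> at_port t j d"
      "node (c (Suc t)) j = node (c t) j" "inside (Suc t) j"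
      "mem (c (Suc t)) j = m\<lparr>Btime := 0\<rparr>"
      "\<not> gains_access landmark lam (ch t) (c t) j (port_side d)"
proof (cases "j \<in> active (ch t) \<and> \<not> gains_access landmark lam (ch t) (c t) j (port_side d)")
  case True
  then have "agent_step n landmark lam (ch t) (c t) j = (node (c t) j, Inside, m\<lparr>Btime := 0\<rparr>)"
    using assms side_of_port_side[OF assms(2)]
    by (simp add: plan_def agent_step_def wanted_side_def)
  \<comment> \<open>Holding the wanted port already counts as access, so an agent that fails was not
    on it.\<close>
  moreover have "\<not> at_port t j d" using True by (auto simp: gains_access_def at_port_def)
  ultimately show ?thesis using True
    by (intro fail) (auto simp: step round_step_def inside_def)
next
  case False
  have "agent_step n landmark lam (ch t) (c t) j =
    cross n (lam j) (ch t) (node (c t) j) (port_side d) m"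
    using assms False side_of_port_side[OF assms(2)]
    by (auto simp: plan_def agent_step_def wanted_side_def port_side_lam split: if_splits place.splits)
  then show ?thesis
    using that(1,2) assms(2) lam_port_side[OF assms(2)]
    by (cases "blocked t j d")
      (use False in \<open>auto simp: step round_step_def cross_def blocked_def towards_def inside_def at_port_def\<close>)
qed

text \<open>A port is denied either because it is occupied or because of a lost tie. In the second
  case the competitor does gain it, which the liveness argument exploits.\<close>

lemma not_gains_access:
  assumes "\<not> gains_access landmark lam (ch t) (c t) j (port_side d)" "node (c t) j < n"
  defines "k \<equiv> other_agent j"
  obtains "node (c t) k = node (c t) j" "at_port t k d"
  | "node (c t) k = node (c t) j" "\<not> at_port t k d" "k \<in> active (ch t)" "snd (plan t k) = Some d"
    "winner (ch t) = k" "\<not> at_port t j d"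
    "gains_access landmark lam (ch t) (c t) k (port_side d)"
proof (cases "at_port t k d")
  case True
  then show ?thesis using assms that(1) by (auto simp: gains_access_def at_port_def Let_def)
next
  case False
  have *: "node (c t) k = node (c t) j" "k \<in> active (ch t)" "winner (ch t) = k"
    "wanted_side landmark lam (c t) k = Some (port_side d)" "\<not> at_port t j d"
    using assms(1) False by (auto simp: gains_access_def at_port_def Let_def k_def)
  then have "snd (plan t k) = Some d"
    using side_of_port_side[of "node (c t) k" k] assms(2)
    by (auto simp: wanted_side_def plan_def)
  moreover have "gains_access landmark lam (ch t) (c t) k (port_side d)"
    using * by (auto simp: gains_access_def at_port_def Let_def k_def)
  ultimately show ?thesis using that(2) * False by blast
qed

lemma towards_less: "towards i d < n"
  using n_ge_3 by (cases "port_side d") (auto simp: towards_def)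

lemma node_less: "node (c t) j < n"
proof (induction t)
  case 0
  then show ?case by (rule initial)
next
  case (Suc t)
  show ?case
  proof (cases "plan t j")
    case (Pair m d)
    show ?thesis
    proof (cases d)
      case None
      with Pair Suc plan_None show ?thesis by metis
    next
      case (Some d')
      with Pair have "plan t j = (m, Some d')" by simp
      then show ?thesis using Suc towards_less by (cases rule: plan_Some[OF _ Suc]) auto
    qed
  qed
qed

text \<open>An agent reads the port of the other one with its own orientation; chirality turns this
  into the port that the other agent itself calls left.\<close>

lemma catches_look: "catches Left (look landmark lam (c t) j) \<longleftrightarrow> caught t j"
proof -
  have *: "map_place (\<lambda>s. lam k (node (c t) k, s)) (place (c t) k) = OnPort Left \<longleftrightarrow> at_port t k Left"
    for k
    by (cases "place (c t) k")
      (auto simp: at_port_def lam_eq_dir_of node_less, metis port_side_dir_of)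
  have **: "map_place (\<lambda>s. lam k (node (c t) k, s)) (place (c t) k) = Inside \<longleftrightarrow> inside t k"
    for k by (cases "place (c t) k") (auto simp: inside_def)
  have "lam j (node (c t) j, s) = lam (other_agent j) (node (c t) j, s)" for s
    by (simp add: lam_eq_dir_of node_less)
  then show ?thesis
    using **[of j] *[of "other_agent j"]
    by (auto simp: catches_def look_def caught_def Let_def)
qed

abbreviation ctl :: "nat \<Rightarrow> agent \<Rightarrow> control" where
  "ctl t j \<equiv> control (mem (c t) j)"

section \<open>Local invariants, decisions of an agent and mutual exclusion\<close>

text \<open>The port that an agent holds determines the direction of its state. The last clause says
  that an agent on a port has already looked at its node, so passive transport away from the
  landmark never skips an observation of it.\<close>

definition basic :: "nat \<Rightarrow> agent \<Rightarrow> bool" where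
  "basic t j \<longleftrightarrow>
     (inside t j \<longrightarrow> Btime (mem (c t) j) = 0) \<and>
     (at_port t j Left \<longrightarrow> ctl t j = Init \<or> ctl t j = Reverse) \<and>
     (at_port t j Right \<longrightarrow> ctl t j = Bounce \<and> Btime (mem (c t) j) > 0) \<and>
     (ctl t j = Init \<longrightarrow> rightSteps (mem (c t) j) = None) \<and>
     (ctl t j = Reverse \<longrightarrow> rightSteps (mem (c t) j) \<noteq> None) \<and>
     (ctl t j \<noteq> Terminate \<longrightarrow> ring_size (mem (c t) j) = None) \<and>
     (\<not> inside t j \<and> node (c t) j = landmark \<longrightarrow> dist (mem (c t) j) = Some 0)"

text \<open>Common to an agent whose Look has not detected a loop and to an unterminated agent
  asleep on a port, whose stored memory already has this form.\<close>

definition looked :: "nat \<Rightarrow> agent \<Rightarrow> memory \<Rightarrow> bool" where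
  "looked t j m \<longleftrightarrow> ring_size m = None \<and>
     (node (c t) j = landmark \<longrightarrow> dist m = Some 0) \<and>
     (dist m = dist (mem (c t) j) \<or>
      dist (mem (c t) j) = None \<and> dist m = Some 0 \<and> node (c t) j = landmark)"

text \<open>The invariant \<open>basic\<close> sharpens \<open>compute_cases\<close>: in
  \<open>Init\<close> there is no \<open>rightSteps\<close>, so only \<open>Reverse\<close> can
  stop; a loop is detected only inside the landmark, since on a port there the distance is 0; a
  reversal happens only on a right port.\<close>

lemma plan_cases:
  assumes "basic t j" "ctl t j \<noteq> Terminate"
  obtains
    (idle) "plan t j = (mem (c t) j, None)" "inside t j" "j \<notin> active (ch t)"
  | (keep) m d where "plan t j = (m, Some d)" "explore_direction (ctl t j) = Some d"
      "control m = ctl t j" "Esteps m = Esteps (mem (c t) j)"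
      "rightSteps m = rightSteps (mem (c t) j)" "Btime m = Btime (mem (c t) j)" "looked t j m"
      "j \<in> active (ch t) \<Longrightarrow> ctl t j = Bounce \<Longrightarrow> Btime m = 0"
      "j \<in> active (ch t) \<Longrightarrow> ctl t j \<noteq> Bounce \<Longrightarrow> \<not> caught t j"
  | (known) m d where "plan t j = (m, None)" "control m = Terminate" "inside t j"
      "node (c t) j = landmark" "dist (mem (c t) j) = Some d" "d \<noteq> 0"
      "Btime m = Btime (mem (c t) j)"
  | (stop) m r where "plan t j = (m, None)" "control m = Terminate" "caught t j"
      "ctl t j = Reverse" "rightSteps (mem (c t) j) = Some r" "Esteps (mem (c t) j) \<le> r"
      "Btime m = Btime (mem (c t) j)"
  | (bounce) m where "plan t j = (m, Some Right)" "control m = Bounce" "caught t j" "Esteps m = 0"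
      "Btime m = 0" "rightSteps m = rightSteps (mem (c t) j)"
      "ctl t j = Init \<or> ctl t j = Reverse"
      "\<And>r. rightSteps (mem (c t) j) = Some r \<Longrightarrow> r < Esteps (mem (c t) j)" "looked t j m"
  | (reverse) m where "plan t j = (m, Some Left)" "control m = Reverse" "at_port t j Right"
      "ctl t j = Bounce" "Btime (mem (c t) j) > 0" "Esteps m = 0"
      "rightSteps m = Some (Esteps (mem (c t) j))" "looked t j m"
proof (cases "j \<in> active (ch t)")
  case False
  show ?thesis
  proof (cases rule: place_cases[OF node_less, of t j])
    case 1
    then show ?thesis using idle False by (simp add: plan_def inside_def)
  next
    case (2 d)
    then have "plan t j = (mem (c t) j, Some d)"
      using False by (simp add: plan_def at_port_def lam_eq_dir_of node_less)
    moreover have "explore_direction (ctl t j) = Some d"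
      using assms(1) 2(1) by (cases d) (auto simp: basic_def)
    moreover have "looked t j (mem (c t) j)"
      using assms 2(2) by (auto simp: basic_def looked_def)
    ultimately show ?thesis using keep False by blast
  qed
next
  case True
  define m where "m = mem (c t) j"
  define s where "s = look landmark lam (c t) j"
  define m1 where "m1 = observe_landmark s m"
  have p: "plan t j = compute s m"
    using True by (simp add: plan_def decision_def s_def m_def)
  have bt: "own_place s = Inside \<longleftrightarrow> inside t j"
    unfolding s_def look_def inside_def by (cases "place (c t) j") (simp_all add: Let_def)
  have b: "own_place s = Inside \<Longrightarrow> Btime m = 0"
    using assms(1) bt by (simp add: basic_def m_def)
  have lm: "at_landmark s \<longleftrightarrow> node (c t) j = landmark"
    by (simp add: s_def look_def Let_def)
  have rs: "ring_size m = None" using assms by (simp add: basic_def m_def)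
  have lk: "looked t j m1" if "\<not> n_known m1"
    using that lm rs
    by (auto simp: looked_def m1_def n_known_def observe_landmark_def m_def split: if_splits option.splits)
  have lk': "looked t j m1 \<Longrightarrow> ring_size m' = ring_size m1 \<Longrightarrow> dist m' = dist m1 \<Longrightarrow> looked t j m'" for m'
    by (auto simp: looked_def)
  have ctch: "catches Left s \<longleftrightarrow> caught t j" by (simp add: s_def catches_look)
  have m1: "control m1 = control m" "Esteps m1 = Esteps m" "Btime m1 = Btime m"
    "rightSteps m1 = rightSteps m"
    by (simp_all add: m1_def)
  show ?thesis
  proof (cases rule: compute_cases[of m s, OF _ b])
    case 1
    then show ?case using assms(2) by (simp add: m_def)
  next
    case 2
    then show ?case .
  next
    case known': 3
    then obtain d where d: "node (c t) j = landmark" "dist m = Some d" "d \<noteq> 0"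
      using lm rs
      by (auto simp: n_known_def observe_landmark_def split: if_splits option.splits)
    then have "inside t j" using assms(1) by (auto simp: basic_def m_def)
    then show ?thesis using known p known' d m1 unfolding m1_def[symmetric] by (simp add: m_def)
  next
    case 4
    then obtain d where d: "explore_direction (control m) = Some d"
      using assms(2) by (cases "control m") (auto simp: m_def)
    then show ?thesis using keep[of m1 d] 4 p lk m1 ctch unfolding m1_def[symmetric] m_def[symmetric]
      by simp
  next
    case (5 r)
    then have "control m = Reverse" using assms(1) by (auto simp: basic_def m_def)
    then show ?thesis using stop 5 p ctch m1 unfolding m1_def[symmetric] m_def[symmetric]
      by simp
  next
    case 6
    have "caught t j" using 6 ctch by simp
    then have "Btime m = 0" using assms(1) by (simp add: caught_def basic_def m_def)
    then show ?thesis using bounce 6 p lk m1 ctch lk' unfolding m1_def[symmetric] m_def[symmetric]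
      by simp
  next
    case 7
    then have "\<not> inside t j" using b bt by auto
    moreover have "\<not> at_port t j Left" using 7 assms(1) by (auto simp: basic_def m_def)
    ultimately have "at_port t j Right"
      using place_cases[OF node_less, of t j] by (metis direction.exhaust)
    then show ?thesis using reverse 7 p lk m1 lk' unfolding m1_def[symmetric] m_def[symmetric]
      by simp
  qed
qed

lemma outside_at_port:
  assumes "\<not> inside t j" obtains d where "at_port t j d"
  using that assms by (cases rule: place_cases[OF node_less, of t j]) auto

lemma inside_not_at_port: "inside t j \<Longrightarrow> \<not> at_port t j d"
  by (simp add: inside_def at_port_def)

lemma at_port_unique: "at_port t j d \<Longrightarrow> at_port t j e \<Longrightarrow> d = e"
  by (simp add: at_port_def)

text \<open>Both ports are tied to nonterminal states. This is what protects a terminated agent from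
  passive transport.\<close>

lemma basic_inside_terminal: "basic t j \<Longrightarrow> ctl t j = Terminate \<Longrightarrow> inside t j"
proof (rule ccontr)
  assume "basic t j" "ctl t j = Terminate" "\<not> inside t j"
  moreover obtain d where "at_port t j d" using outside_at_port[OF \<open>\<not> inside t j\<close>] .
  ultimately show False by (cases d) (auto simp: basic_def)
qed

lemma plan_terminal:
  assumes "inside t j" "ctl t j = Terminate"
  obtains m where "plan t j = (m, None)" "control m = Terminate"
proof (cases "j \<in> active (ch t)")
  case True
  then have "plan t j = (observe_landmark (look landmark lam (c t) j) (mem (c t) j), None)"
    using assms(2) by (simp add: plan_def decision_def compute_def run_explore_None)
  then show ?thesis using that assms(2) by simp
next
  case False
  then show ?thesis using that assms by (simp add: plan_def inside_def)
qed

lemma terminal_Suc: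
  assumes "basic t j" "ctl t j = Terminate"
  shows "ctl (Suc t) j = Terminate" "node (c (Suc t)) j = node (c t) j" "inside (Suc t) j"
proof -
  have i: "inside t j" using assms by (rule basic_inside_terminal)
  obtain m where "plan t j = (m, None)" "control m = Terminate"
    using plan_terminal[OF i assms(2)] .
  then show "ctl (Suc t) j = Terminate" "node (c (Suc t)) j = node (c t) j" "inside (Suc t) j"
    using plan_None i by (auto simp: inside_def)
qed

lemma memory_counts [simp]:
  "control (count_move d m) = control m" "control (count_wait m) = control m"
  "rightSteps (count_move d m) = rightSteps m" "rightSteps (count_wait m) = rightSteps m"
  "ring_size (count_move d m) = ring_size m" "ring_size (count_wait m) = ring_size m"
  "Esteps (count_move d m) = Suc (Esteps m)" "Esteps (count_wait m) = Esteps m"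
  "Btime (count_move d m) = 0" "Btime (count_wait m) = Suc (Btime m)"
  "dist (count_wait m) = dist m"
  by (auto simp: count_move_def count_wait_def)

lemma basic_Suc_Some:
  assumes "plan t j = (m, Some d)" "looked t j m" "explore_direction (control m) = Some d"
    "control m = Init \<longrightarrow> rightSteps m = None" "control m = Reverse \<longrightarrow> rightSteps m \<noteq> None"
  shows "basic (Suc t) j"
proof -
  have ctl: "control m \<noteq> Terminate" using assms(3) by auto
  show ?thesis
    using assms(1) node_less
  proof (cases rule: plan_Some)
    case move
    then show ?thesis using assms inside_not_at_port
      by (auto simp: basic_def looked_def)
  next
    case wait
    then have p: "\<not> inside (Suc t) j" "at_port (Suc t) j e \<longleftrightarrow> e = d" for e
      by (auto simp: inside_not_at_port dest: at_port_unique inside_not_at_port)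
    show ?thesis
      using wait p assms ctl
      by (cases "control m") (auto simp: basic_def looked_def)
  next
    case fail
    then show ?thesis using assms inside_not_at_port
      by (auto simp: basic_def looked_def)
  qed
qed

lemma basic: "basic t j"
proof (induction t)
  case 0
  then show ?case by (simp add: basic_def initial inside_def at_port_def init_memory_def)
next
  case (Suc t)
  show ?case
  proof (cases "ctl t j = Terminate")
    case True
    obtain m where m: "plan t j = (m, None)" "control m = Terminate"
      using plan_terminal[OF basic_inside_terminal[OF Suc True] True] .
    have "inside (Suc t) j" "ctl (Suc t) j = Terminate" using terminal_Suc[OF Suc True] by auto
    moreover have "Btime (mem (c (Suc t)) j) = 0"
    proof -
      have "Btime m = Btime (mem (c t) j)"
        using m True
        by (auto simp: plan_def decision_def compute_def run_explore_None split: if_splits)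
      then show ?thesis
        using plan_None[OF m(1)] Suc basic_inside_terminal[OF Suc True] by (auto simp: basic_def)
    qed
    ultimately show ?thesis using inside_not_at_port by (auto simp: basic_def)
  next
    case False
    show ?thesis
      using Suc False
    proof (cases rule: plan_cases)
      case idle
      then show ?thesis using plan_None[OF idle(1)] Suc
        by (auto simp: basic_def inside_def at_port_def)
    next
      case (keep m d)
      then show ?thesis using Suc by (intro basic_Suc_Some[of t j m d]) (auto simp: basic_def)
    next
      case (known m d)
      then have "ctl (Suc t) j = Terminate" "inside (Suc t) j" "Btime (mem (c (Suc t)) j) = 0"
        using plan_None[OF known(1)] Suc by (auto simp: basic_def inside_def)
      then show ?thesis using inside_not_at_port by (auto simp: basic_def)
    next
      case (stop m r)
      then have "ctl (Suc t) j = Terminate" "inside (Suc t) j" "Btime (mem (c (Suc t)) j) = 0"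
        using plan_None[OF stop(1)] Suc by (auto simp: basic_def inside_def caught_def)
      then show ?thesis using inside_not_at_port by (auto simp: basic_def)
    next
      case (bounce m)
      then show ?thesis by (intro basic_Suc_Some[of t j m Right]) auto
    next
      case (reverse m)
      then show ?thesis by (intro basic_Suc_Some[of t j m Left]) auto
    qed
  qed
qed

lemma at_port_Suc:
  assumes "at_port (Suc t) j d"
  obtains m where "plan t j = (m, Some d)" "node (c (Suc t)) j = node (c t) j" "blocked t j d"
    "j \<notin> active (ch t) \<longrightarrow> at_port t j d"
    "j \<in> active (ch t) \<longrightarrow> gains_access landmark lam (ch t) (c t) j (port_side d)"
proof (cases "plan t j")
  case (Pair m e)
  show ?thesis
  proof (cases e)
    case None
    then have p: "plan t j = (m, None)" using Pair by simp
    \<comment> \<open>Without a direction an agent keeps its place, and every such outcome occurs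
      inside the node, so it cannot lead to a port.\<close>
    have "inside t j"
    proof (cases "ctl t j = Terminate")
      case True
      then show ?thesis by (rule basic_inside_terminal[OF basic])
    next
      case False
      show ?thesis
        using basic False by (cases rule: plan_cases) (use p in \<open>auto simp: caught_def\<close>)
    qed
    then show ?thesis
      using plan_None[OF p] assms by (simp add: inside_def at_port_def)
  next
    case (Some e')
    then have p: "plan t j = (m, Some e')" using Pair by simp
    show ?thesis
      using p node_less
    proof (cases rule: plan_Some)
      case wait
      then have [simp]: "e' = d" using assms at_port_unique by blast
      have "j \<notin> active (ch t) \<longrightarrow> at_port t j d"
        using p by (auto simp: plan_def at_port_def lam_eq_dir_of node_less split: place.splits if_splits)
      then show ?thesis using p wait that by simp
    qed (use assms inside_not_at_port in auto)
  qed
qed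

lemma exclusion:
  "node (c t) (other_agent j) = node (c t) j \<Longrightarrow> at_port t j d \<Longrightarrow> \<not> at_port t (other_agent j) d"
proof (induction t arbitrary: j)
  case 0
  then show ?case by (simp add: at_port_def initial)
next
  case (Suc t)
  define k where "k = other_agent j"
  show ?case
  proof
    assume "at_port (Suc t) (other_agent j) d"
    then have "at_port (Suc t) k d" by (simp add: k_def)
    then obtain mk where k: "plan t k = (mk, Some d)" "node (c (Suc t)) k = node (c t) k"
      "k \<notin> active (ch t) \<longrightarrow> at_port t k d"
      "k \<in> active (ch t) \<longrightarrow> gains_access landmark lam (ch t) (c t) k (port_side d)"
      by (rule at_port_Suc) blast
    obtain mj where j: "plan t j = (mj, Some d)" "node (c (Suc t)) j = node (c t) j"
      "j \<notin> active (ch t) \<longrightarrow> at_port t j d"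
      "j \<in> active (ch t) \<longrightarrow> gains_access landmark lam (ch t) (c t) j (port_side d)"
      using Suc.prems(2) by (rule at_port_Suc) blast
    have eq: "node (c t) k = node (c t) j" using Suc.prems(1) j(2) k(2) by (simp add: k_def)
    have wants: "i \<in> active (ch t) \<Longrightarrow> plan t i = (m, Some d) \<Longrightarrow>
      wanted_side landmark lam (c t) i = Some (port_side d)" for i m
      by (simp add: plan_def wanted_side_def side_of_port_side node_less)
    have "\<not> (at_port t j d \<and> at_port t k d)" using Suc.IH[of j] eq by (auto simp: k_def)
    moreover have "winner (ch t) = j \<or> winner (ch t) = k"
      using agent_eq_or_other[of "winner (ch t)" j] by (simp only: k_def)
    moreover have gj: "j \<in> active (ch t) \<Longrightarrow> at_port t j d \<or> \<not> at_port t k d \<and>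
      \<not> (k \<in> active (ch t) \<and> winner (ch t) = k)"
      using j(4) eq k_def[symmetric] wants[OF _ k(1)]
      by (auto simp: gains_access_def Let_def at_port_def)
    moreover have gk: "k \<in> active (ch t) \<Longrightarrow> at_port t k d \<or> \<not> at_port t j d \<and>
      \<not> (j \<in> active (ch t) \<and> winner (ch t) = j)"
      using k(4) eq wants[OF _ j(1)]
      by (auto simp: gains_access_def Let_def at_port_def k_def)
    ultimately show False using j(3) k(3) by blast
  qed
qed

section \<open>Lifted walks and blocked edges\<close>

text \<open>The lift of the walk of an agent to the integers, growing to the right; the node is recovered
  modulo \<open>n\<close>, up to the sign \<open>sg\<close> which tells whether right is clockwise.\<close>

definition sg :: int where
  "sg = (if port_side Right = Plus then 1 else -1)"

primrec sign :: "direction \<Rightarrow> int" where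
  "sign Left = -1"
| "sign Right = 1"

primrec lift :: "nat \<Rightarrow> agent \<Rightarrow> int" where
  "lift 0 j = sg * int (node (c 0) j)"
| "lift (Suc t) j = lift t j +
     (if node (c (Suc t)) j = node (c t) j then 0
      else if node (c (Suc t)) j = towards (node (c t) j) Right then 1 else -1)"

lemma sg_cases: "sg = 1 \<or> sg = -1" by (simp add: sg_def)

lemma sg_mult [simp]: "sg * sg = 1" "sg * (sg * x) = x" using sg_cases by auto

lemma port_side_cases: "port_side d = (if sg * sign d = 1 then Plus else Minus)"
proof -
  have "port_side Left \<noteq> port_side Right" by simp
  then show ?thesis
    by (cases d; cases "port_side Left"; cases "port_side Right") (auto simp: sg_def simp del: port_side_eq_iff)
qed

lemma int_pred_mod: "int ((i + n - Suc 0) mod n) = (int i - 1) mod int n"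
proof -
  have "int (i + n - Suc 0) = (int i - 1) + int n" using n_ge_3 by simp
  then show ?thesis by (simp only: zmod_int mod_add_self2)
qed

lemma int_Suc_mod: "int (Suc i mod n) = (int i + 1) mod int n"
  by (simp only: zmod_int of_nat_Suc add.commute)

lemma int_towards: "int (towards i d) = (int i + sg * sign d) mod int n"
  using port_side_cases[of d] sg_cases
  by (cases d) (auto simp: towards_def int_pred_mod int_Suc_mod)

lemma towards_neq: "i < n \<Longrightarrow> towards i d \<noteq> i"
proof
  assume i: "i < n" and eq: "towards i d = i"
  have "(int i + sg * sign d) mod int n = int i mod int n"
    using int_towards[of i d] eq i by simp
  then have "int n dvd sg * sign d" by (simp add: mod_eq_dvd_iff)
  then show False using sg_cases n_ge_3 by (cases d) auto
qed

text \<open>The two neighbours differ by 2, which \<open>n\<close> does not divide since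
  \<open>n >= 3\<close>. Hence the direction of a move, and with it the lift, can be read off the
  nodes alone.\<close>

lemma towards_Left_neq_Right: "towards i Left \<noteq> towards i Right"
proof
  assume "towards i Left = towards i Right"
  then have "(int i + sg * sign Right) mod int n = (int i + sg * sign Left) mod int n"
    using int_towards by metis
  then have "int n dvd 2 * sg" by (simp add: mod_eq_dvd_iff)
  then have "int n dvd 2" using sg_cases by auto
  then have "int n \<le> 2" by (rule zdvd_imp_le) simp
  then show False using n_ge_3 by simp
qed

lemma lift_move:
  "node (c (Suc t)) j = towards (node (c t) j) d \<Longrightarrow> lift (Suc t) j = lift t j + sign d"
  using towards_neq[OF node_less, of t j d] towards_Left_neq_Right[of "node (c t) j"]
  by (cases d) auto

lemma lift_stay: "node (c (Suc t)) j = node (c t) j \<Longrightarrow> lift (Suc t) j = lift t j"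
  by simp

lemma round_node_cases:
  obtains d where "node (c (Suc t)) j = towards (node (c t) j) d" | "node (c (Suc t)) j = node (c t) j"
proof (cases "plan t j")
  case (Pair m e)
  then show ?thesis
  proof (cases e)
    case None
    then show ?thesis using Pair plan_None that(2) by blast
  next
    case (Some d)
    then have "plan t j = (m, Some d)" using Pair by simp
    from this node_less show ?thesis by (cases rule: plan_Some) (use that in auto)
  qed
qed

lemma node_lift: "int (node (c t) j) = (sg * lift t j) mod int n"
proof (induction t)
  case 0
  then show ?case using initial by (simp add: mult.assoc[symmetric])
next
  case (Suc t)
  show ?case
  proof (cases rule: round_node_cases[of t j])
    case (1 d)
    have "int (node (c (Suc t)) j) = (sg * lift t j + sg * sign d) mod int n"
      using Suc 1 by (simp add: int_towards mod_simps)
    then show ?thesis using lift_move[OF 1] by (simp only: distrib_left)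
  next
    case 2
    then show ?thesis using Suc by simp
  qed
qed

lemma dvd_sg_iff: "int n dvd sg * x \<longleftrightarrow> int n dvd x"
  using sg_cases by auto

lemma node_eq_iff: "node (c t) j = node (c s) k \<longleftrightarrow> int n dvd lift t j - lift s k"
proof -
  have "node (c t) j = node (c s) k \<longleftrightarrow> (sg * lift t j) mod int n = (sg * lift s k) mod int n"
    by (simp only: node_lift[symmetric] of_nat_eq_iff)
  also have "\<dots> \<longleftrightarrow> int n dvd sg * (lift t j - lift s k)"
    by (simp add: mod_eq_dvd_iff right_diff_distrib)
  finally show ?thesis by (simp add: dvd_sg_iff)
qed

lemma lift_step: "\<bar>lift (Suc t) j - lift t j\<bar> \<le> 1" by simp

lemma int_edge_of: "i < n \<Longrightarrow> int (edge_of n (i, port_side d)) =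
   (if sg * sign d = 1 then int i else (int i - 1) mod int n)"
  using port_side_cases[of d] by (auto simp: int_pred_mod)

text \<open>Only one edge is missing, so the two agents face each other across it and
  \<open>k\<close> is at the right neighbour of the node of \<open>j\<close>.\<close>

lemma blocked_opposite:
  assumes "blocked t j Right" "blocked t k Left"
  shows "int n dvd lift t j + 1 - lift t k"
proof -
  have eq: "int (edge_of n (node (c t) j, port_side Right)) =
      int (edge_of n (node (c t) k, port_side Left))"
    using assms by (simp add: blocked_def)
  have "int n dvd sg * (lift t j + 1 - lift t k)"
  proof (cases "sg = 1")
    case True
    then have "int (node (c t) j) mod int n = (int (node (c t) k) - 1) mod int n"
      using eq node_less by (simp add: int_edge_of)
    then show ?thesis using True node_lift
      by (simp add: mod_simps) (simp add: mod_eq_dvd_iff algebra_simps)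
  next
    case False
    then have F: "sg = -1" using sg_cases by simp
    then have "(int (node (c t) j) - 1) mod int n = int (node (c t) k) mod int n"
      using eq node_less by (simp add: int_edge_of)
    then show ?thesis using F node_lift
      by (simp add: mod_simps) (simp add: mod_eq_dvd_iff algebra_simps)
  qed
  then show ?thesis by (simp add: dvd_sg_iff)
qed

text \<open>The single missing edge has only one endpoint from which it leads in direction
  \<open>d\<close>.\<close>

lemma blocked_same:
  assumes "blocked t j d" "blocked t k d" shows "node (c t) j = node (c t) k"
proof -
  have eq: "int (edge_of n (node (c t) j, port_side d)) =
      int (edge_of n (node (c t) k, port_side d))"
    using assms by (simp add: blocked_def)
  show ?thesis
  proof (cases "sg * sign d = 1")
    case True
    then show ?thesis using eq node_less by (simp add: int_edge_of)
  next
    case False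
    then have "(int (node (c t) j) - 1) mod int n = (int (node (c t) k) - 1) mod int n"
      using eq node_less by (simp add: int_edge_of)
    then have "((int (node (c t) j) - 1) + 1) mod int n = ((int (node (c t) k) - 1) + 1) mod int n"
      by (rule mod_add_cong) simp
    then show ?thesis using node_less by simp
  qed
qed

lemma lift_between:
  assumes "s1 \<le> T" "s2 \<le> T" "lift s1 j \<le> z" "z \<le> lift s2 j"
  shows "\<exists>s\<le>T. lift s j = z"
proof (cases "s1 \<le> s2")
  case True
  have "\<exists>i. s1 \<le> i \<and> i \<le> s2 \<and> lift i j = z"
    by (rule nat_intermed_int_val) (use True assms lift_step in auto)
  then show ?thesis using assms(2) le_trans by blast
next
  case False
  have "\<exists>i. s2 \<le> i \<and> i \<le> s1 \<and> - lift i j = - z"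
    by (rule nat_intermed_int_val) (use False assms lift_step in auto)
  then show ?thesis using assms(1) by (metis le_trans neg_equal_iff_equal)
qed

section \<open>Criteria for exploration in terms of lifts\<close>

text \<open>The interval from \<open>u\<close> to \<open>v\<close> contains \<open>n\<close>
  consecutive integers and thus a lift of every node; it does not matter which agent visits it, nor
  on which sheet.\<close>

lemma explored_window:
  assumes "v - u \<ge> int n - 1"
    and "\<And>z. u \<le> z \<Longrightarrow> z \<le> v \<Longrightarrow> \<exists>s\<le>T. \<exists>j. int n dvd lift s j - z"
  shows "explored_by n c T"
  unfolding explored_by_def
proof (intro allI impI)
  fix i assume i: "i < n"
  \<comment> \<open>The first lift of node \<open>i\<close> that is not left of
    \<open>u\<close>.\<close>
  define z where "z = u + (sg * int i - u) mod int n"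
  have "u \<le> z" "z < u + int n" using n_ge_3 by (auto simp: z_def)
  then obtain s j where s: "s \<le> T" "int n dvd lift s j - z" using assms by force
  have "int n dvd z - sg * int i"
    by (auto simp: z_def mod_eq_dvd_iff[symmetric] mod_simps)
  with s(2) have "int n dvd (lift s j - z) + (z - sg * int i)" by (rule dvd_add)
  then have "int n dvd sg * (lift s j - sg * int i)" by (simp add: dvd_sg_iff)
  then have "(sg * lift s j) mod int n = int i mod int n"
    by (simp add: mod_eq_dvd_iff right_diff_distrib)
  then have "node (c s) j = i" using node_lift[of s j] i by simp
  then show "\<exists>t\<le>T. \<exists>j. node (c t) j = i" using s(1) by blast
qed

lemma explored_single:
  assumes "s1 \<le> T" "s2 \<le> T" "lift s2 j - lift s1 j \<ge> int n - 1"
  shows "explored_by n c T"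
  using assms(3)
proof (rule explored_window)
  fix z assume "lift s1 j \<le> z" "z \<le> lift s2 j"
  then obtain s where "s \<le> T" "lift s j = z" using lift_between assms by blast
  then show "\<exists>s\<le>T. \<exists>j. int n dvd lift s j - z" by (metis diff_self dvd_0_right)
qed

text \<open>The leftward walk of \<open>k\<close> and the rightward walk of \<open>j\<close> begin
  at a common node, so after a translation by a multiple of \<open>n\<close> they cover one
  interval. The window uses the coordinates of \<open>k\<close>.\<close>

lemma explored_joint:
  assumes "s \<le> T" "node (c s) j = node (c s) k" "lift T j \<ge> lift s j" "lift T k \<le> lift s k"
    and "(lift T j - lift s j) - (lift T k - lift s k) \<ge> int n - 1"
  shows "explored_by n c T"
proof (rule explored_window)
  show "(lift s k + (lift T j - lift s j)) - lift T k \<ge> int n - 1" using assms(5) by simp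
next
  fix z assume z: "lift T k \<le> z" "z \<le> lift s k + (lift T j - lift s j)"
  show "\<exists>r\<le>T. \<exists>i. int n dvd lift r i - z"
  proof (cases "z \<le> lift s k")
    case True
    then obtain r where "r \<le> T" "lift r k = z"
      using lift_between[of T T s k z] z assms by blast
    then show ?thesis by (metis diff_self dvd_0_right)
  next
    case False
    \<comment> \<open>This is \<open>z\<close> in the coordinates of \<open>j\<close>.\<close>
    then obtain r where r: "r \<le> T" "lift r j = z - lift s k + lift s j"
      using lift_between[of s T T j "z - lift s k + lift s j"] z assms by force
    moreover have "int n dvd lift s j - lift s k" using assms(2) by (simp add: node_eq_iff)
    ultimately show ?thesis by (intro exI[of _ r] conjI exI[of _ j]) simp_all
  qed
qed

lemma explored_mono: "explored_by n c s \<Longrightarrow> s \<le> t \<Longrightarrow> explored_by n c t"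
  unfolding explored_by_def by (meson le_trans)

section \<open>Tracking of the landmark\<close>

text \<open>The first lift of the landmark at or to the right of the start. Together with the
  previous one, \<open>landmark_lift j - int n\<close>, it encloses the walk until the first
  encounter.\<close>

definition landmark_lift :: "agent \<Rightarrow> int" where
  "landmark_lift j = lift 0 j + (sg * int landmark - lift 0 j) mod int n"

lemma landmark_lift_bounds: "lift 0 j \<le> landmark_lift j" "landmark_lift j < lift 0 j + int n"
  using n_ge_3 by (auto simp: landmark_lift_def)

lemma at_landmark_iff: "node (c t) j = landmark \<longleftrightarrow> int n dvd lift t j - landmark_lift j"
proof -
  have "int n dvd landmark_lift j - sg * int landmark"
    by (auto simp: landmark_lift_def mod_eq_dvd_iff[symmetric] mod_simps)
  then have "int n dvd (lift t j - landmark_lift j) + (landmark_lift j - sg * int landmark) \<longleftrightarrow>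
      int n dvd lift t j - landmark_lift j"
    by (rule dvd_add_left_iff)
  then have *: "int n dvd lift t j - landmark_lift j \<longleftrightarrow> int n dvd lift t j - sg * int landmark"
    by simp
  have "node (c t) j = landmark \<longleftrightarrow> (sg * lift t j) mod int n = int landmark mod int n"
    unfolding node_lift[symmetric] using landmark_less by simp
  also have "\<dots> \<longleftrightarrow> int n dvd sg * (lift t j - sg * int landmark)"
    by (simp add: mod_eq_dvd_iff right_diff_distrib)
  finally show ?thesis using * by (simp add: dvd_sg_iff)
qed

lemma dvd_landmark_lift:
  assumes "y = landmark_lift j - int n \<or> y = landmark_lift j"
  shows "int n dvd x - landmark_lift j \<longleftrightarrow> int n dvd x - y"
  using assms
proof
  assume "y = landmark_lift j - int n"
  then have "x - y = (x - landmark_lift j) + int n" by simp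
  then show ?thesis by (simp only: dvd_add_triv_right_iff)
qed simp

text \<open>Once the landmark has been met, \<open>lift t j - d\<close> is the position of this
  encounter: one of the two lifts next to the start, and visited before.\<close>

definition dist_ok :: "nat \<Rightarrow> agent \<Rightarrow> int option \<Rightarrow> bool" where
  "dist_ok t j D \<longleftrightarrow>
     (case D of
        None \<Rightarrow> landmark_lift j - int n \<le> lift t j \<and> lift t j \<le> landmark_lift j
      | Some d \<Rightarrow> \<bar>d\<bar> \<le> int n \<and> (\<exists>s\<le>t. lift s j = lift t j - d) \<and>
          (lift t j - d = landmark_lift j - int n \<or> lift t j - d = landmark_lift j))"

text \<open>The form valid after a Look that has not detected a loop. The strict inequalities leave
  room for exactly one further step within \<open>dist_ok\<close>.\<close>

definition dist_strict :: "nat \<Rightarrow> agent \<Rightarrow> int option \<Rightarrow> bool" where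
  "dist_strict t j D \<longleftrightarrow> dist_ok t j D \<and>
     (case D of
        None \<Rightarrow> landmark_lift j - int n < lift t j \<and> lift t j < landmark_lift j
      | Some d \<Rightarrow> \<bar>d\<bar> < int n)"

text \<open>On the boundary the agent is over the landmark. There Look either sets the distance to 0
  or, at distance \<open>n\<close>, detects the loop, which \<open>looked\<close> excludes.\<close>

lemma dist_strict_looked:
  assumes "dist_ok t j (dist (mem (c t) j))" "looked t j m"
  shows "dist_strict t j (dist m)"
proof (cases "dist m")
  case None
  then have "dist (mem (c t) j) = None" "node (c t) j \<noteq> landmark"
    using assms(2) by (auto simp: looked_def)
  then have *: "landmark_lift j - int n \<le> lift t j" "lift t j \<le> landmark_lift j"
    "\<not> int n dvd lift t j - landmark_lift j"
    using assms(1) by (auto simp: dist_ok_def at_landmark_iff)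
  moreover have "lift t j \<noteq> landmark_lift j" "lift t j \<noteq> landmark_lift j - int n"
    using *(3) by auto
  ultimately show ?thesis using None by (auto simp: dist_ok_def dist_strict_def)
next
  case (Some d)
  show ?thesis
  proof (cases "dist (mem (c t) j)")
    case None
    then have d: "d = 0" "node (c t) j = landmark" using Some assms(2) by (auto simp: looked_def)
    have "landmark_lift j - int n \<le> lift t j" "lift t j \<le> landmark_lift j"
      "int n dvd lift t j - landmark_lift j"
      using None assms(1) d(2) by (auto simp: dist_ok_def at_landmark_iff)
    \<comment> \<open>A multiple of \<open>n\<close> between 0 and \<open>n\<close> is one of the
      two ends.\<close>
    then have "lift t j = landmark_lift j - int n \<or> lift t j = landmark_lift j"
      using zdvd_not_zless[of "landmark_lift j - lift t j" "int n"]
      by (subst (asm) dvd_diff_commute) linarith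
    then show ?thesis using Some d n_ge_3 by (auto simp: dist_ok_def dist_strict_def)
  next
    case (Some d')
    with \<open>dist m = Some d\<close> have d: "dist (mem (c t) j) = Some d" using assms(2) by (auto simp: looked_def)
    with assms(1) have *: "\<bar>d\<bar> \<le> int n"
      "lift t j - d = landmark_lift j - int n \<or> lift t j - d = landmark_lift j"
      by (auto simp: dist_ok_def)
    have "\<bar>d\<bar> \<noteq> int n"
    proof
      assume n: "\<bar>d\<bar> = int n"
      have "int n dvd \<bar>d\<bar>" unfolding n by simp
      then have "int n dvd lift t j - (lift t j - d)" by simp
      then have "int n dvd lift t j - landmark_lift j" using dvd_landmark_lift[OF *(2)] by blast
      then have "d = 0" using \<open>dist m = Some d\<close> assms(2) by (auto simp: at_landmark_iff looked_def)
      with n n_ge_3 show False by simp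
    qed
    then show ?thesis using assms(1) d * \<open>dist m = Some d\<close> by (auto simp: dist_strict_def)
  qed
qed

lemma dist_ok_move:
  assumes "dist_strict t j D" "lift (Suc t) j = lift t j + sign d"
  shows "dist_ok (Suc t) j (map_option (\<lambda>x. x + sign d) D)"
proof (cases D)
  case None
  then show ?thesis using assms by (cases d) (auto simp: dist_ok_def dist_strict_def)
next
  case (Some x)
  then obtain s where "s \<le> t" "lift s j = lift t j - x" using assms by (auto simp: dist_ok_def dist_strict_def)
  then have "s \<le> Suc t" "lift s j = lift (Suc t) j - (x + sign d)" using assms(2) by auto
  moreover have "\<bar>x + sign d\<bar> \<le> int n" using assms Some by (cases d) (auto simp: dist_strict_def)
  ultimately show ?thesis using assms Some by (auto simp: dist_ok_def dist_strict_def)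
qed

lemma dist_ok_stay:
  assumes "dist_ok t j D" "lift (Suc t) j = lift t j" shows "dist_ok (Suc t) j D"
  using assms by (auto simp: dist_ok_def split: option.splits intro: le_SucI)

lemma dist_count_move: "dist (count_move d m) = map_option (\<lambda>x. x + sign d) (dist m)"
  by (cases d) (auto simp: count_move_def)

lemma dist_ok: "ctl t j \<noteq> Terminate \<Longrightarrow> dist_ok t j (dist (mem (c t) j))"
proof (induction t)
  case 0
  then show ?case
    using landmark_lift_bounds[of j] by (simp add: initial init_memory_def dist_ok_def)
next
  case (Suc t)
  have nt: "ctl t j \<noteq> Terminate" using Suc.prems terminal_Suc[OF basic] by blast
  with Suc.IH have IH: "dist_ok t j (dist (mem (c t) j))" .
  have main: ?case if "plan t j = (m, Some d)" "looked t j m" for m d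
  proof -
    have strict: "dist_strict t j (dist m)" using IH that(2) by (rule dist_strict_looked)
    then have ok: "dist_ok t j (dist m)" by (simp add: dist_strict_def)
    show ?thesis
      using that(1) node_less
    proof (cases rule: plan_Some)
      case move
      then show ?thesis using dist_ok_move[OF strict lift_move] by (simp add: dist_count_move)
    qed (use dist_ok_stay[OF ok] in auto)
  qed
  show ?case
    using basic nt
  proof (cases rule: plan_cases)
    case idle
    then show ?thesis using plan_None[OF idle(1)] IH dist_ok_stay lift_stay by metis
  qed (use main Suc.prems plan_None in auto)
qed

text \<open>The distance is a nonzero multiple of \<open>n\<close>, so the walk from the first
  encounter to the present position passes over a full period.\<close>

lemma known_explored:
  assumes "ctl t j \<noteq> Terminate" "node (c t) j = landmark" "dist (mem (c t) j) = Some d" "d \<noteq> 0"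
  shows "explored_by n c t"
proof -
  have ok: "dist_ok t j (Some d)" using dist_ok[OF assms(1)] assms(3) by simp
  then obtain s where s: "s \<le> t" "lift s j = lift t j - d" "\<bar>d\<bar> \<le> int n"
    "lift s j = landmark_lift j - int n \<or> lift s j = landmark_lift j"
    by (auto simp: dist_ok_def)
  have "int n dvd lift t j - landmark_lift j" using assms(2) by (simp add: at_landmark_iff)
  then have "int n dvd lift t j - lift s j"
    using dvd_landmark_lift[OF s(4)] by blast
  then have "int n dvd d" using s(2) by simp
  then have "\<bar>d\<bar> \<ge> int n" using assms(4) dvd_imp_le_int[of d "int n"] by simp
  then show ?thesis
    using explored_single[of s t t j] explored_single[of t t s j] s by (cases "d > 0") auto
qed

text \<open>One \<open>n\<close> separates the start from the first encounter at most, another one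
  the encounter from the current position. In the round of its termination an agent does not
  move.\<close>

lemma lift_bound: "\<bar>lift t j - lift 0 j\<bar> \<le> 2 * int n"
proof (induction t)
  case 0
  then show ?case by simp
next
  case (Suc t)
  show ?case
  proof (cases "ctl (Suc t) j = Terminate")
    case False
    show ?thesis
      using dist_ok[OF False] landmark_lift_bounds[of j]
      by (auto simp: dist_ok_def simp del: lift.simps split: option.splits)
  next
    case T: True
    have "node (c (Suc t)) j = node (c t) j"
    proof (cases "ctl t j = Terminate")
      case True
      then show ?thesis using terminal_Suc[OF basic] by blast
    next
      case False
      show ?thesis
        using basic False
      proof (cases rule: plan_cases)
        case (keep m d)
        have "control (mem (c (Suc t)) j) = control m"
          using keep(1) node_less by (cases rule: plan_Some) auto
        then show ?thesis using keep T False by simp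
      next
        case (bounce m)
        have "control (mem (c (Suc t)) j) = control m"
          using bounce(1) node_less by (cases rule: plan_Some) auto
        then show ?thesis using bounce T by simp
      next
        case (reverse m)
        have "control (mem (c (Suc t)) j) = control m"
          using reverse(1) node_less by (cases rule: plan_Some) auto
        then show ?thesis using reverse T by simp
      qed (use plan_None in auto)
    qed
    then show ?thesis using Suc by simp
  qed
qed

lemma abs_lift_le: "\<bar>lift t j\<bar> \<le> 3 * int n"
proof -
  have "\<bar>lift 0 j\<bar> \<le> int n" using sg_cases initial(1)[of j] by auto
  then show ?thesis using lift_bound[of t j] by linarith
qed

section \<open>The quadratic bound on the number of moves\<close>

primrec moves :: "nat \<Rightarrow> agent \<Rightarrow> int" where
  "moves 0 j = 0"
| "moves (Suc t) j = moves t j + (if node (c (Suc t)) j = node (c t) j then 0 else 1)"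

text \<open>\<open>N\<close> bounds the absolute value of all positions. An excursion thus costs at most \<open>4 N\<close>, and its
  start, recovered from the position and the counters, strictly decreases from one to the next.\<close>

definition cost_ok :: "int \<Rightarrow> int \<Rightarrow> int \<Rightarrow> memory \<Rightarrow> bool" where
  "cost_ok N k x m \<longleftrightarrow>
     (case control m of
        Init \<Rightarrow> k \<le> N - x
      | Bounce \<Rightarrow> \<bar>x - int (Esteps m)\<bar> \<le> N \<and>
          k \<le> (N - (x - int (Esteps m))) * (4 * N) + 2 * N + int (Esteps m)
      | Reverse \<Rightarrow> (\<exists>r y. rightSteps m = Some r \<and> y = x - int r + int (Esteps m) \<and>
          \<bar>y\<bar> \<le> N \<and> \<bar>y + int r\<bar> \<le> N \<and> k \<le> (N - y) * (4 * N) + 2 * N + int r + int (Esteps m))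
      | Terminate \<Rightarrow> k \<le> 8 * N * N + 6 * N)"

lemma cost_ok_move:
  assumes "cost_ok N k x m" "explore_direction (control m) = Some d"
  shows "cost_ok N (k + 1) (x + sign d) (count_move d m)"
  using assms by (cases "control m") (auto simp: cost_ok_def algebra_simps)

lemma cost_ok_cong:
  "cost_ok N k x m \<Longrightarrow> control m' = control m \<Longrightarrow> Esteps m' = Esteps m \<Longrightarrow>
    rightSteps m' = rightSteps m \<Longrightarrow> cost_ok N k x m'"
  unfolding cost_ok_def by (simp only:)

text \<open>Here \<open>y\<close> is the start of an excursion with \<open>r\<close> steps to the
  right and \<open>e\<close> to the left so far, and \<open>x\<close> is the current position. Each
  part has length at most \<open>2 * N\<close>. If \<open>r < e\<close>, then \<open>x\<close> is at
  least one unit left of \<open>y\<close>, and this unit is worth \<open>4 * N\<close>, enough to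
  pay for both parts.\<close>

lemma excursion_bound:
  fixes N x y k r e :: int
  assumes "\<bar>y\<bar> \<le> N" "\<bar>y + r\<bar> \<le> N" "k \<le> (N - y) * (4 * N) + 2 * N + r + e" "x = y + r - e" "\<bar>x\<bar> \<le> N"
  shows "k \<le> 8 * N * N + 6 * N" and "r < e \<Longrightarrow> k \<le> (N - x) * (4 * N) + 2 * N"
proof -
  have N: "N \<ge> 0" using assms(1) by simp
  have "(N - y) * (4 * N) \<le> (2 * N) * (4 * N)"
    using assms(1) N by (intro mult_right_mono) auto
  then show "k \<le> 8 * N * N + 6 * N" using assms by (simp add: algebra_simps)
  assume "r < e"
  then have "(N - y + 1) * (4 * N) \<le> (N - x) * (4 * N)"
    using assms N by (intro mult_right_mono) auto
  moreover have "(N - y + 1) * (4 * N) = (N - y) * (4 * N) + 4 * N" by (simp add: algebra_simps)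
  moreover have "r + e \<le> 4 * N" using assms by linarith
  ultimately show "k \<le> (N - x) * (4 * N) + 2 * N" using assms(3) by linarith
qed

lemma cost_ok_terminate:
  assumes "cost_ok N k x m" "\<bar>x\<bar> \<le> N" "control m' = Terminate"
  shows "cost_ok N k x m'"
proof -
  have N: "N \<ge> 0" using assms(2) by simp
  have "k \<le> 8 * N * N + 6 * N"
  proof (cases "control m")
    case Init
    then show ?thesis using assms N by (auto simp: cost_ok_def intro: order_trans[of _ "2 * N"])
  next
    case Bounce
    \<comment> \<open>An agent in \<open>Bounce\<close> is on an excursion whose leftward part is
      still empty, hence the 0.\<close>
    then show ?thesis using assms
        excursion_bound(1)[of "x - int (Esteps m)" N "int (Esteps m)" k 0 x]
      by (auto simp: cost_ok_def)
  next
    case Reverse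
    then show ?thesis using assms excursion_bound(1)[of _ N _ k _ x] by (force simp: cost_ok_def)
  next
    case Terminate
    then show ?thesis using assms by (simp add: cost_ok_def)
  qed
  then show ?thesis using assms(3) by (simp add: cost_ok_def)
qed

lemma cost_ok: "cost_ok (3 * int n) (moves t j) (lift t j) (mem (c t) j)"
proof (induction t)
  case 0
  then show ?case using abs_lift_le[of 0 j]
    by (simp add: cost_ok_def initial init_memory_def)
next
  case (Suc t)
  define N where "N = 3 * int n"
  note IH = Suc[folded N_def]
  have x: "\<bar>lift t j\<bar> \<le> N" unfolding N_def by (rule abs_lift_le)
  have none: ?case if "plan t j = (m, None)" "cost_ok N (moves t j) (lift t j) m" for m
    using plan_None[OF that(1)] that(2) by (simp add: N_def)
  have some: ?case if p: "plan t j = (m, Some d)" and ok: "cost_ok N (moves t j) (lift t j) m"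
    and d: "explore_direction (control m) = Some d" for m d
    using p node_less
  proof (cases rule: plan_Some)
    case move
    then have "moves (Suc t) j = moves t j + 1" using towards_neq[OF node_less] by simp
    then show ?thesis using cost_ok_move[OF ok d] lift_move[OF move(2)] move(4)
      by (simp only: N_def)
  next
    case wait
    then show ?thesis using cost_ok_cong[OF ok, of "mem (c (Suc t)) j"] by (simp add: N_def)
  next
    case fail
    then show ?thesis using cost_ok_cong[OF ok, of "mem (c (Suc t)) j"] by (simp add: N_def)
  qed
  show ?case
  proof (cases "ctl t j = Terminate")
    case True
    obtain m where "plan t j = (m, None)" "control m = Terminate"
      using plan_terminal[OF basic_inside_terminal[OF basic True] True] .
    then show ?thesis using none cost_ok_terminate[OF IH x] by blast
  next
    case False
    show ?thesis
      using basic False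
    proof (cases rule: plan_cases)
      case idle
      then show ?thesis using none IH by blast
    next
      case (keep m d)
      then show ?thesis using some cost_ok_cong[OF IH] by simp
    next
      case (known m d)
      then show ?thesis using none cost_ok_terminate[OF IH x] by blast
    next
      case (stop m r)
      then show ?thesis using none cost_ok_terminate[OF IH x] by blast
    next
      case (bounce m)
      have "moves t j \<le> (N - lift t j) * (4 * N) + 2 * N"
      proof (cases "ctl t j = Init")
        case True
        \<comment> \<open>The initial walk only goes left, within \<open>[-N, N]\<close>; the
          summand \<open>2 * N\<close> in the bounds for later states accounts for it.\<close>
        then have "moves t j \<le> 2 * N" using IH x by (auto simp: cost_ok_def)
        moreover have "0 \<le> (N - lift t j) * (4 * N)" using x by (intro mult_nonneg_nonneg) auto
        ultimately show ?thesis by linarith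
      next
        case False
        \<comment> \<open>A further bounce requires \<open>rightSteps < Esteps\<close>, the extra
          hypothesis of the second part of \<open>excursion_bound\<close>.\<close>
        then show ?thesis
          using IH bounce(7,8) x excursion_bound(2)[of _ N _ "moves t j" _ "lift t j"]
          by (force simp: cost_ok_def)
      qed
      then show ?thesis using some[OF bounce(1)] bounce x by (simp add: cost_ok_def)
    next
      case (reverse m)
      then have "cost_ok N (moves t j) (lift t j) m" using IH x by (auto simp: cost_ok_def)
      then show ?thesis using some[OF reverse(1)] reverse by simp
    qed
  qed
qed

lemma moves_le: "moves t j \<le> 90 * int n * int n"
proof -
  have "cost_ok (3 * int n) (moves t j) (lift t j) (init_memory\<lparr>control := Terminate\<rparr>)"
    by (rule cost_ok_terminate[OF cost_ok abs_lift_le]) simp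
  \<comment> \<open>This is \<open>8 * N * N + 6 * N\<close> for
    \<open>N = 3 * int n\<close>.\<close>
  then have "moves t j \<le> 72 * (int n * int n) + 18 * int n" by (simp add: cost_ok_def)
  also have "18 * int n \<le> 18 * (int n * int n)" using n_ge_3 by simp
  finally show ?thesis by simp
qed

lemma moves_card: "moves T j = int (card {t. t < T \<and> node (c (Suc t)) j \<noteq> node (c t) j})"
proof (induction T)
  case 0
  then show ?case by simp
next
  case (Suc T)
  have "{t. t < Suc T \<and> node (c (Suc t)) j \<noteq> node (c t) j} =
    {t. t < T \<and> node (c (Suc t)) j \<noteq> node (c t) j} \<union>
    (if node (c (Suc T)) j = node (c T) j then {} else {T})"
    by (auto simp: less_Suc_eq)
  then show ?case using Suc by (auto simp: card_insert_if)
qed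

lemma traversals_le: "int (traversals c T) \<le> 180 * int n * int n"
  using moves_le[of T A] moves_le[of T B] by (simp add: traversals_def moves_card)

section \<open>Safety: no termination before exploration\<close>

definition leftward :: "nat \<Rightarrow> agent \<Rightarrow> bool" where
  "leftward t j \<longleftrightarrow> ctl t j = Init \<or> ctl t j = Reverse"

lemma leftward_at_port: "at_port t j Left \<Longrightarrow> leftward t j"
  using basic[of t j] by (simp add: basic_def leftward_def)

text \<open>A leftward state is left only by a catch or by termination, both excluded here. An agent
  on its left port cannot fail to access it, so if it does not move, its edge is missing.\<close>

lemma leftward_round:
  assumes "leftward t j" "\<not> caught t j" "ctl (Suc t) j \<noteq> Terminate"
  shows "leftward (Suc t) j" "lift (Suc t) j \<le> lift t j"
    "at_port t j Left \<Longrightarrow> lift (Suc t) j = lift t j \<Longrightarrow> at_port (Suc t) j Left \<and> blocked t j Left"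
proof -
  have nt: "ctl t j \<noteq> Terminate" using assms(1) by (auto simp: leftward_def)
  have "leftward (Suc t) j \<and> lift (Suc t) j \<le> lift t j \<and>
    (at_port t j Left \<longrightarrow> lift (Suc t) j = lift t j \<longrightarrow> at_port (Suc t) j Left \<and> blocked t j Left)"
    using basic nt
  proof (cases rule: plan_cases[of t j])
    case idle
    then show ?thesis
      using plan_None[OF idle(1)] assms inside_not_at_port by (auto simp: leftward_def)
  next
    case (keep m d)
    then have d: "d = Left" using assms(1) by (auto simp: leftward_def)
    show ?thesis
      using keep(1)[unfolded d] node_less
    proof (cases rule: plan_Some)
      case move
      then show ?thesis using keep assms(1) lift_move[OF move(2)]
        by (simp add: leftward_def del: lift.simps)
    qed (use keep assms(1) in \<open>auto simp: leftward_def\<close>)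
  next
    case (known m d)
    then show ?thesis using plan_None assms by auto
  next
    case (stop m r)
    then show ?thesis using assms by auto
  next
    case (bounce m)
    then show ?thesis using assms by auto
  next
    case (reverse m)
    then show ?thesis using assms by (auto simp: leftward_def)
  qed
  then show "leftward (Suc t) j" "lift (Suc t) j \<le> lift t j"
    "at_port t j Left \<Longrightarrow> lift (Suc t) j = lift t j \<Longrightarrow> at_port (Suc t) j Left \<and> blocked t j Left"
    by blast+
qed

text \<open>To be caught an agent must be on its left port, where only leftward agents stand. So
  during a bounce the partner is not diverted from going left.\<close>

lemma Bounce_not_caught: "ctl t j = Bounce \<Longrightarrow> \<not> caught t (other_agent j)"
  using leftward_at_port[of t j] by (auto simp: caught_def leftward_def)

lemma meet_again_explored:
  assumes "s \<le> t" "node (c s) j = node (c s) k" "node (c t) j = node (c t) k"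
    and "lift s j \<le> lift t j" "lift t k < lift s k"
  shows "explored_by n c t"
proof (rule explored_joint[OF assms(1,2)])
  have "int n dvd (lift t j - lift t k) - (lift s j - lift s k)"
    using assms(2,3) unfolding node_eq_iff by (rule dvd_diff[rotated])
  then have "int n \<le> (lift t j - lift t k) - (lift s j - lift s k)"
    by (rule zdvd_imp_le) (use assms in simp)
  then show "int n - 1 \<le> lift t j - lift s j - (lift t k - lift s k)" by simp
qed (use assms in auto)

text \<open>\<open>s\<close> is the round of the last catch of \<open>j\<close>, and \<open>k\<close> is the other agent.\<close>

definition bounce_ok :: "nat \<Rightarrow> nat \<Rightarrow> agent \<Rightarrow> agent \<Rightarrow> memory \<Rightarrow> bool" where
  "bounce_ok s t j k m \<longleftrightarrow> s \<le> t \<and> node (c s) j = node (c s) k \<and>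
     lift t j = lift s j + int (Esteps m) \<and> lift t k \<le> lift s k \<and> leftward t k \<and>
     (lift t k = lift s k \<longrightarrow> at_port t k Left) \<and> (Btime m > 0 \<longrightarrow> lift t k < lift s k)"

text \<open>The two alternatives at the end match the test of the protocol: left of the old catch
  point \<open>j\<close> has \<open>Esteps\<close> above \<open>rightSteps\<close> and will not
  stop; otherwise \<open>k\<close> is strictly left of its own position at that catch.\<close>

definition reverse_ok :: "nat \<Rightarrow> nat \<Rightarrow> agent \<Rightarrow> agent \<Rightarrow> memory \<Rightarrow> bool" where
  "reverse_ok s t j k m \<longleftrightarrow> s \<le> t \<and> node (c s) j = node (c s) k \<and>
     (\<exists>r. rightSteps m = Some r \<and> lift t j = lift s j + int r - int (Esteps m)) \<and>
     (lift t j < lift s j \<or> lift t k < lift s k \<and> leftward t k)"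

definition joint_ok :: "nat \<Rightarrow> agent \<Rightarrow> bool" where
  "joint_ok t j \<longleftrightarrow>
     (ctl t j = Bounce \<longrightarrow> (\<exists>s. bounce_ok s t j (other_agent j) (mem (c t) j))) \<and>
     (ctl t j = Reverse \<longrightarrow> (\<exists>s. reverse_ok s t j (other_agent j) (mem (c t) j)))"

lemma bounce_ok_cong: "bounce_ok s t j k m \<Longrightarrow> Esteps m' = Esteps m \<Longrightarrow> Btime m' = Btime m \<Longrightarrow>
    bounce_ok s t j k m'"
  by (simp add: bounce_ok_def)

lemma reverse_ok_cong: "reverse_ok s t j k m \<Longrightarrow> Esteps m' = Esteps m \<Longrightarrow>
    rightSteps m' = rightSteps m \<Longrightarrow> reverse_ok s t j k m'"
  by (simp add: reverse_ok_def)

text \<open>At the catch \<open>k\<close> was on its left port. It can leave this position only to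
  the left, so an unchanged lift means that it is still blocked there.\<close>

lemma bounce_ok_partner:
  assumes "bounce_ok s t j k m" "\<not> caught t k" "ctl (Suc t) k \<noteq> Terminate"
  shows "lift (Suc t) k \<le> lift t k" "lift (Suc t) k \<le> lift s k" "leftward (Suc t) k"
    "lift (Suc t) k = lift s k \<longrightarrow> at_port (Suc t) k Left \<and> blocked t k Left"
proof -
  have s: "lift t k \<le> lift s k" "leftward t k" "lift t k = lift s k \<longrightarrow> at_port t k Left"
    using assms(1) by (simp_all add: bounce_ok_def)
  note l = leftward_round[OF s(2) assms(2,3)]
  show "lift (Suc t) k \<le> lift t k" "lift (Suc t) k \<le> lift s k" "leftward (Suc t) k"
    using l(1,2) s(1) by (auto simp del: lift.simps)
  show "lift (Suc t) k = lift s k \<longrightarrow> at_port (Suc t) k Left \<and> blocked t k Left"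
  proof
    assume "lift (Suc t) k = lift s k"
    moreover from this have "lift t k = lift s k" using l(2) s(1) by linarith
    ultimately show "at_port (Suc t) k Left \<and> blocked t k Left" using l(3) s(3) by simp
  qed
qed

lemma bounce_ok_Suc:
  assumes p: "plan t j = (m, Some Right)" and ok: "bounce_ok s t j k m"
    and k: "\<not> caught t k" "ctl (Suc t) k \<noteq> Terminate" and ne: "\<not> explored_by n c t"
  shows "bounce_ok s (Suc t) j k (mem (c (Suc t)) j)"
proof -
  note l = bounce_ok_partner[OF ok k]
  have s: "s \<le> t" "node (c s) j = node (c s) k" "lift t j = lift s j + int (Esteps m)"
    "lift t k \<le> lift s k" "Btime m > 0 \<longrightarrow> lift t k < lift s k"
    using ok by (simp_all add: bounce_ok_def)
  show ?thesis
    using p node_less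
  proof (cases rule: plan_Some)
    case move
    then show ?thesis using lift_move[OF move(2)] s l
      by (simp add: bounce_ok_def del: lift.simps)
  next
    case wait
    \<comment> \<open>Otherwise both are blocked at opposite ends of the missing edge. Then
      \<open>n\<close> divides \<open>Esteps m + 1\<close>, so \<open>j\<close> alone has gone at
      least \<open>n - 1\<close> steps and has seen the whole ring.\<close>
    have "lift (Suc t) k \<noteq> lift s k"
    proof
      assume eq: "lift (Suc t) k = lift s k"
      then have lk: "lift t k = lift s k" using l(1) s(4) by linarith
      have "int n dvd lift t j + 1 - lift t k"
        using blocked_opposite[OF wait(1)] l(4) eq by simp
      moreover have "int n dvd lift s j - lift s k" using s(2) by (simp add: node_eq_iff)
      ultimately have "int n dvd (lift t j + 1 - lift t k) - (lift s j - lift s k)"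
        by (rule dvd_diff)
      then have "int n dvd int (Esteps m) + 1" using s(3) lk by (simp add: algebra_simps)
      then have "int n \<le> int (Esteps m) + 1" by (rule zdvd_imp_le) simp
      then have "explored_by n c t" using explored_single[of s t t j] s by simp
      then show False using ne by simp
    qed
    then have "lift (Suc t) k < lift s k" using l(2) by linarith
    then show ?thesis using lift_stay[OF wait(2)] wait s l
      by (simp add: bounce_ok_def del: lift.simps)
  next
    case fail
    then show ?thesis using lift_stay[OF fail(3)] s l
      by (simp add: bounce_ok_def del: lift.simps)
  qed
qed

text \<open>While \<open>j\<close> is not left of the catch point and \<open>k\<close> is strictly
  left of it, a meeting would complete the exploration. Hence \<open>k\<close> does not catch
  \<open>j\<close> and goes on to the left.\<close>

lemma reverse_ok_partner:
  assumes "reverse_ok s t j (other_agent j) m" "ctl (Suc t) (other_agent j) \<noteq> Terminate"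
    "\<not> explored_by n c t" "lift (Suc t) j \<le> lift t j"
  shows "lift (Suc t) j < lift s j \<or>
    lift (Suc t) (other_agent j) < lift s (other_agent j) \<and> leftward (Suc t) (other_agent j)"
proof (cases "lift t j < lift s j")
  case True
  then show ?thesis using assms(4) by linarith
next
  case False
  define k where "k = other_agent j"
  have s: "s \<le> t" "node (c s) j = node (c s) k" "lift t k < lift s k" "leftward t k"
    using assms(1) False by (auto simp: reverse_ok_def k_def)
  have "node (c t) j \<noteq> node (c t) k"
    using meet_again_explored[OF s(1,2) _ _ s(3)] False assms(3) by auto
  then have nc: "\<not> caught t k" by (simp add: caught_def k_def)
  have k: "ctl (Suc t) k \<noteq> Terminate" using assms(2) by (simp add: k_def)
  have "lift (Suc t) k < lift s k \<and> leftward (Suc t) k"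
    using leftward_round(1,2)[OF s(4) nc k] s(3) by linarith
  then show ?thesis by (simp add: k_def del: lift.simps)
qed

lemma reverse_ok_Suc:
  assumes p: "plan t j = (m, Some Left)" and ok: "reverse_ok s t j (other_agent j) m"
    and k: "ctl (Suc t) (other_agent j) \<noteq> Terminate" and ne: "\<not> explored_by n c t"
  shows "reverse_ok s (Suc t) j (other_agent j) (mem (c (Suc t)) j)"
proof -
  obtain r where s: "s \<le> t" "node (c s) j = node (c s) (other_agent j)"
    "rightSteps m = Some r" "lift t j = lift s j + int r - int (Esteps m)"
    using ok by (auto simp: reverse_ok_def)
  note l = reverse_ok_partner[OF ok k ne]
  show ?thesis
    using p node_less
  proof (cases rule: plan_Some)
    case move
    then show ?thesis using lift_move[OF move(2)] s l
      by (simp add: reverse_ok_def del: lift.simps)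
  next
    case wait
    then show ?thesis using lift_stay[OF wait(2)] s l
      by (simp add: reverse_ok_def del: lift.simps)
  next
    case fail
    then show ?thesis using lift_stay[OF fail(3)] s l
      by (simp add: reverse_ok_def del: lift.simps)
  qed
qed

lemma control_Suc: "plan t j = (m, Some d) \<Longrightarrow> ctl (Suc t) j = control m"
  by (erule plan_Some[OF _ node_less]) auto

lemma joint_ok:
  assumes "\<And>i. ctl t i \<noteq> Terminate" "\<not> explored_by n c t"
  shows "joint_ok t j"
  using assms
proof (induction t arbitrary: j)
  case 0
  then show ?case by (simp add: joint_ok_def initial init_memory_def)
next
  case (Suc t j)
  have nt: "ctl t i \<noteq> Terminate" for i
    using Suc.prems(1) terminal_Suc[OF basic] by blast
  have ne: "\<not> explored_by n c t" using Suc.prems(2) explored_mono[of t "Suc t"] by auto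
  have IH: "joint_ok t j" for j using Suc.IH nt ne by blast
  define k where "k = other_agent j"
  have k_nt: "ctl (Suc t) k \<noteq> Terminate" by (rule Suc.prems)
  have J: "ctl t j = Bounce \<Longrightarrow> \<exists>s. bounce_ok s t j k (mem (c t) j)"
    "ctl t j = Reverse \<Longrightarrow> \<exists>s. reverse_ok s t j k (mem (c t) j)"
    using IH[of j] by (simp_all add: joint_ok_def k_def)
  have goal: "joint_ok (Suc t) j" if "ctl (Suc t) j = Bounce \<Longrightarrow> \<exists>s. bounce_ok s (Suc t) j k (mem (c (Suc t)) j)"
    "ctl (Suc t) j = Reverse \<Longrightarrow> \<exists>s. reverse_ok s (Suc t) j k (mem (c (Suc t)) j)"
    using that by (simp add: joint_ok_def k_def)
  have nc: "\<not> caught t k" if "ctl t j = Bounce"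
    using that by (simp add: k_def Bounce_not_caught)
  show ?case
    using basic nt
  proof (cases rule: plan_cases[of t j])
    case idle
    note p = plan_None[OF idle(1)]
    have l: "lift (Suc t) j = lift t j" using p by simp
    show ?thesis
    proof (rule goal)
      assume "ctl (Suc t) j = Bounce"
      then have b: "ctl t j = Bounce" using p by simp
      then obtain s where s: "bounce_ok s t j k (mem (c t) j)" using J by blast
      have "bounce_ok s (Suc t) j k (mem (c t) j)"
        using s bounce_ok_partner[OF s nc[OF b] k_nt] l
        by (auto simp: bounce_ok_def simp del: lift.simps)
      then show "\<exists>s. bounce_ok s (Suc t) j k (mem (c (Suc t)) j)" using p by auto
    next
      assume "ctl (Suc t) j = Reverse"
      then have "ctl t j = Reverse" using p by simp
      then obtain s where s: "reverse_ok s t j k (mem (c t) j)" using J by blast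
      have "reverse_ok s (Suc t) j k (mem (c t) j)"
        using s reverse_ok_partner[OF s[unfolded k_def] k_nt[unfolded k_def] ne] l
        by (simp add: reverse_ok_def k_def del: lift.simps)
      then show "\<exists>s. reverse_ok s (Suc t) j k (mem (c (Suc t)) j)" using p by auto
    qed
  next
    case (keep m d)
    have cs: "ctl (Suc t) j = ctl t j" using control_Suc[OF keep(1)] keep(3) by simp
    show ?thesis
    proof (rule goal)
      assume "ctl (Suc t) j = Bounce"
      then have b: "ctl t j = Bounce" using cs by simp
      then obtain s where s: "bounce_ok s t j k (mem (c t) j)" using J by blast
      have "plan t j = (m, Some Right)" using keep(1,2) b by simp
      from bounce_ok_Suc[OF this bounce_ok_cong[OF s keep(4,6)] nc[OF b] k_nt ne]
      show "\<exists>s. bounce_ok s (Suc t) j k (mem (c (Suc t)) j)" ..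
    next
      assume "ctl (Suc t) j = Reverse"
      then have b: "ctl t j = Reverse" using cs by simp
      then obtain s where s: "reverse_ok s t j k (mem (c t) j)" using J by blast
      have "plan t j = (m, Some Left)" using keep(1,2) b by simp
      from reverse_ok_Suc[OF this reverse_ok_cong[OF s keep(4,5), unfolded k_def]
          k_nt[unfolded k_def] ne]
      show "\<exists>s. reverse_ok s (Suc t) j k (mem (c (Suc t)) j)" unfolding k_def ..
    qed
  next
    case (known m d)
    then show ?thesis using plan_None Suc.prems(1)[of j] by auto
  next
    case (stop m r)
    then show ?thesis using plan_None Suc.prems(1)[of j] by auto
  next
    case (bounce m)
    have k: "node (c t) j = node (c t) k" "at_port t k Left" "\<not> caught t k"
      using bounce(3) inside_not_at_port by (auto simp: caught_def k_def)
    \<comment> \<open>The current catch becomes the reference round, with zero displacements; being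
      caught puts \<open>k\<close> on its left port.\<close>
    have "bounce_ok t t j k m"
      using k leftward_at_port bounce(4,5) by (simp add: bounce_ok_def)
    from bounce_ok_Suc[OF bounce(1) this k(3) k_nt ne]
    have "bounce_ok t (Suc t) j k (mem (c (Suc t)) j)" .
    moreover have "ctl (Suc t) j = Bounce" using control_Suc[OF bounce(1)] bounce(2) by simp
    ultimately show ?thesis by (intro goal) auto
  next
    case (reverse m)
    obtain s where "bounce_ok s t j k (mem (c t) j)" using J reverse(4) by blast
    \<comment> \<open>A reversal requires \<open>Btime > 0\<close>, and in this case
      \<open>bounce_ok\<close> places \<open>k\<close> strictly left of its position at the
      catch.\<close>
    then have "reverse_ok s t j k m"
      using reverse(5,6,7) by (simp add: bounce_ok_def reverse_ok_def)
    from reverse_ok_Suc[OF reverse(1) this[unfolded k_def] k_nt[unfolded k_def] ne]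
    have "reverse_ok s (Suc t) j k (mem (c (Suc t)) j)" by (simp only: k_def)
    moreover have "ctl (Suc t) j = Reverse" using control_Suc[OF reverse(1)] reverse(2) by simp
    ultimately show ?thesis by (intro goal) auto
  qed
qed

lemma first_terminal_explored:
  assumes nt: "\<And>i. ctl t i \<noteq> Terminate" and T: "ctl (Suc t) j = Terminate"
  shows "explored_by n c t"
proof (rule ccontr)
  assume ne: "\<not> explored_by n c t"
  have joint: "joint_ok t j" using nt ne by (rule joint_ok)
  show False
    using basic nt
  proof (cases rule: plan_cases[of t j])
    case idle
    then show False using plan_None(3)[OF idle(1)] T nt by simp
  next
    case (keep m d)
    have "ctl (Suc t) j = control m" using keep(1) by (rule control_Suc)
    then show False using keep T nt by simp
  next
    case (known m d)
    then show False using known_explored nt ne by blast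
  next
    case (stop m r)
    then obtain s where s: "s \<le> t" "node (c s) j = node (c s) (other_agent j)"
      "lift t j = lift s j + int r - int (Esteps (mem (c t) j))"
      "lift t j < lift s j \<or> lift t (other_agent j) < lift s (other_agent j)"
      using joint by (auto simp: joint_ok_def reverse_ok_def)
    have "node (c t) j = node (c t) (other_agent j)" using stop(3) by (simp add: caught_def)
    \<comment> \<open>The test \<open>Esteps <= r\<close> means that \<open>j\<close> is not left of
      the catch point, so the second alternative of \<open>s(4)\<close> holds.\<close>
    then show False using meet_again_explored[OF s(1,2)] s(3,4) stop(6) ne by simp
  next
    case (bounce m)
    have "ctl (Suc t) j = control m" using bounce(1) by (rule control_Suc)
    then show False using bounce T by simp
  next
    case (reverse m)
    have "ctl (Suc t) j = control m" using reverse(1) by (rule control_Suc)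
    then show False using reverse T by simp
  qed
qed

text \<open>Exploration persists, so only the round of the first termination needs an
  argument.\<close>

lemma terminal_explored: "ctl (Suc t) j = Terminate \<Longrightarrow> explored_by n c t"
proof (induction t arbitrary: j)
  case (Suc t)
  show ?case
  proof (cases "\<exists>i. ctl (Suc t) i = Terminate")
    case True
    then show ?thesis using Suc.IH explored_mono[of t "Suc t"] by auto
  next
    case False
    then show ?thesis using Suc.prems first_terminal_explored by blast
  qed
next
  case 0
  then show ?case using first_terminal_explored[of 0] by (simp add: initial init_memory_def)
qed

section \<open>Liveness: everything eventually stands still\<close>

lemma node_neq_towards: "node (c t) j \<noteq> towards (node (c t) j) d"
  using towards_neq[OF node_less] by metis

text \<open>A potential for rounds without moves. With \<open>Esteps = 0\<close> an agent in
  \<open>Reverse\<close> cannot bounce again, since this needs \<open>rightSteps < Esteps\<close>;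
  with earlier moves it can, hence the higher value 3.\<close>

definition rank :: "memory \<Rightarrow> nat" where
  "rank m = (case control m of Init \<Rightarrow> 3 | Bounce \<Rightarrow> 2
     | Reverse \<Rightarrow> (if Esteps m = 0 then 1 else 3) | Terminate \<Rightarrow> 0)"

lemma rank_cong: "control m' = control m \<Longrightarrow> Esteps m' = Esteps m \<Longrightarrow> rank m' = rank m"
  by (simp add: rank_def)

lemma rank_plan:
  assumes "plan t j = (m, d)" "node (c (Suc t)) j = node (c t) j"
  shows "rank (mem (c (Suc t)) j) = rank m"
proof (cases d)
  case None
  then show ?thesis using assms plan_None by simp
next
  case (Some e)
  then have "plan t j = (m, Some e)" using assms by simp
  from this node_less show ?thesis
  proof (cases rule: plan_Some)
    case move
    then show ?thesis using assms(2) node_neq_towards by simp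
  qed (auto intro: rank_cong)
qed

lemma rank_decreases:
  assumes "ctl t j \<noteq> Terminate" "node (c (Suc t)) j = node (c t) j"
  obtains
    (less) "rank (mem (c (Suc t)) j) < rank (mem (c t) j)"
  | (idle) "rank (mem (c (Suc t)) j) = rank (mem (c t) j)" "plan t j = (mem (c t) j, None)"
      "inside t j" "j \<notin> active (ch t)"
  | (keep) m d where "rank (mem (c (Suc t)) j) = rank (mem (c t) j)" "plan t j = (m, Some d)"
      "explore_direction (ctl t j) = Some d" "control m = ctl t j"
      "j \<in> active (ch t) \<longrightarrow> ctl t j = Bounce \<longrightarrow> Btime (mem (c t) j) = 0"
      "j \<in> active (ch t) \<longrightarrow> ctl t j \<noteq> Bounce \<longrightarrow> \<not> caught t j"
  using basic assms(1)
proof (cases rule: plan_cases)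
  case idle': idle
  then show ?thesis using idle rank_plan[OF _ assms(2)] by blast
next
  case keep': (keep m d)
  show ?thesis
    using keep[OF _ keep'(1,2,3)] keep'(6,8,9) rank_plan[OF keep'(1) assms(2)] rank_cong[OF keep'(3,4)]
    by simp
next
  case (known m d)
  then show ?thesis using less rank_plan[OF known(1) assms(2)] assms(1)
    by (cases "ctl t j") (auto simp: rank_def)
next
  case (stop m r)
  then show ?thesis using less rank_plan[OF stop(1) assms(2)] by (simp add: rank_def split: if_splits)
next
  case (bounce m)
  have "rank m < rank (mem (c t) j)"
  proof (cases "ctl t j = Init")
    case False
    \<comment> \<open>In \<open>Reverse\<close> the value \<open>rightSteps\<close> is defined and
      less than \<open>Esteps\<close>, so \<open>Esteps\<close> is positive and the rank is
      3.\<close>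
    then have R: "ctl t j = Reverse" using bounce(7) by simp
    then obtain r where "rightSteps (mem (c t) j) = Some r" using basic[of t j] by (auto simp: basic_def)
    then show ?thesis using R bounce(2) bounce(8) by (force simp: rank_def)
  qed (use bounce(2) in \<open>simp add: rank_def\<close>)
  then show ?thesis using less rank_plan[OF bounce(1) assms(2)] by simp
next
  case (reverse m)
  then show ?thesis using less rank_plan[OF reverse(1) assms(2)] by (simp add: rank_def)
qed

section \<open>Configurations that no longer change nodes or states\<close>

text \<open>By \<open>rank_decreases\<close> the constant rank rules out every change of state,
  including termination.\<close>

definition still :: "nat \<Rightarrow> bool" where
  "still T \<longleftrightarrow> (\<forall>t\<ge>T. \<forall>j. node (c (Suc t)) j = node (c t) j \<and>
     (ctl t j \<noteq> Terminate \<longrightarrow> rank (mem (c (Suc t)) j) = rank (mem (c t) j)))"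

lemma moves_mono: "moves t j \<le> moves (Suc t) j"
  by simp

lemma eventually_no_moves: "\<exists>T. \<forall>t\<ge>T. node (c (Suc t)) j = node (c t) j"
proof -
  define f where "f t = nat (90 * int n * int n - moves t j)" for t
  have "f (Suc t) \<le> f t" for t
    unfolding f_def using moves_mono[of t j] by (intro nat_mono) linarith
  then obtain T where T: "\<forall>t\<ge>T. f (Suc t) = f t"
    using nat_antimono_stable[of 0 f] by blast
  have "node (c (Suc t)) j = node (c t) j" if "t \<ge> T" for t
  proof -
    have "f (Suc t) = f t" using T that by simp
    then have "moves (Suc t) j = moves t j" using moves_le[of t j] moves_le[of "Suc t" j] by (simp add: f_def)
    then show ?thesis by (simp split: if_splits)
  qed
  then show ?thesis by blast
qed

lemma rank_le:
  assumes "node (c (Suc t)) j = node (c t) j" shows "rank (mem (c (Suc t)) j) \<le> rank (mem (c t) j)"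
proof (cases "ctl t j = Terminate")
  case True
  then show ?thesis using terminal_Suc(1)[OF basic True] by (simp add: rank_def)
next
  case False
  from False assms show ?thesis by (cases rule: rank_decreases) auto
qed

lemma eventually_still: "\<exists>T. still T"
proof -
  have "\<exists>T. \<forall>t\<ge>T. node (c (Suc t)) j = node (c t) j \<and> rank (mem (c (Suc t)) j) = rank (mem (c t) j)" for j
  proof -
    obtain T0 where T0: "\<forall>t\<ge>T0. node (c (Suc t)) j = node (c t) j" using eventually_no_moves by blast
    then obtain T where "T \<ge> T0" "\<forall>t\<ge>T. rank (mem (c (Suc t)) j) = rank (mem (c t) j)"
      using nat_antimono_stable[of T0 "\<lambda>t. rank (mem (c t) j)"] rank_le by auto
    then show ?thesis using T0 by (intro exI[of _ T]) auto
  qed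
  then obtain T where T: "\<And>j t. t \<ge> T j \<Longrightarrow> node (c (Suc t)) j = node (c t) j \<and>
    rank (mem (c (Suc t)) j) = rank (mem (c t) j)" by metis
  have "still (max (T A) (T B))"
    unfolding still_def
  proof (intro allI impI)
    fix t j assume "max (T A) (T B) \<le> t"
    then have "T j \<le> t" by (cases j) auto
    then show "node (c (Suc t)) j = node (c t) j \<and>
     (ctl t j \<noteq> Terminate \<longrightarrow> rank (mem (c (Suc t)) j) = rank (mem (c t) j))"
      using T by blast
  qed
  then show ?thesis ..
qed

lemma still_cases:
  assumes "still T" "T \<le> t" "ctl t j \<noteq> Terminate"
  obtains
    (idle) "inside t j" "j \<notin> active (ch t)" "inside (Suc t) j" "ctl (Suc t) j = ctl t j"
  | (wait) d where "explore_direction (ctl t j) = Some d" "blocked t j d" "at_port (Suc t) j d"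
      "ctl (Suc t) j = ctl t j" 
      "j \<in> active (ch t) \<longrightarrow> ctl t j = Bounce \<longrightarrow> Btime (mem (c t) j) = 0"
      "j \<in> active (ch t) \<longrightarrow> ctl t j \<noteq> Bounce \<longrightarrow> \<not> caught t j"
  | (fail) d where "explore_direction (ctl t j) = Some d" "j \<in> active (ch t)"
      "ctl (Suc t) j = ctl t j" "\<not> at_port t j d" "inside (Suc t) j"
      "\<not> gains_access landmark lam (ch t) (c t) j (port_side d)"
      "ctl t j = Bounce \<longrightarrow> Btime (mem (c t) j) = 0" "ctl t j \<noteq> Bounce \<longrightarrow> \<not> caught t j"
proof -
  have st: "node (c (Suc t)) j = node (c t) j" "rank (mem (c (Suc t)) j) = rank (mem (c t) j)"
    using assms by (auto simp: still_def)
  show thesis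
    using assms(3) st(1)
  proof (cases rule: rank_decreases)
    case less
    then show ?thesis using st(2) by simp
  next
    case idle': idle
    then show ?thesis using idle plan_None[OF idle'(2)] by (simp add: inside_def)
  next
    case (keep m d)
    have cs: "ctl (Suc t) j = ctl t j" using control_Suc[OF keep(2)] keep(4) by simp
    show ?thesis
      using keep(2) node_less
    proof (cases rule: plan_Some)
      case move
      then show ?thesis using st(1) node_neq_towards by simp
    next
      case wait': wait
      then show ?thesis using wait keep cs by blast
    next
      case fail': fail
      then show ?thesis using fail keep cs by blast
    qed
  qed
qed

lemma still_ctl:
  assumes "still T" "T \<le> t" "t \<le> s" shows "ctl s j = ctl t j"
  using assms(3)
proof (induction s rule: dec_induct)
  case (step s)
  have "ctl (Suc s) j = ctl s j"
  proof (cases "ctl s j = Terminate")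
    case True
    then show ?thesis using terminal_Suc(1)[OF basic True] by simp
  next
    case False
    have "T \<le> s" using assms(2) step by simp
    from assms(1) this False show ?thesis by (cases rule: still_cases) auto
  qed
  then show ?case using step by simp
qed simp

lemma still_node:
  assumes "still T" "T \<le> t" "t \<le> s" shows "node (c s) j = node (c t) j"
  using assms(3)
proof (induction s rule: dec_induct)
  case (step s)
  then show ?case using assms by (simp add: still_def)
qed simp

lemma at_port_direction: "at_port t j d \<Longrightarrow> explore_direction (ctl t j) = Some d"
  using basic[of t j] by (cases d) (auto simp: basic_def)

text \<open>The port fixes the direction that is tried, and access to it is certain. Without moves
  only waiting remains, so the edge is missing.\<close>

lemma at_port_stays:
  assumes "still T" "T \<le> t" "at_port t j d" shows "at_port (Suc t) j d \<and> blocked t j d"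
proof -
  have d: "explore_direction (ctl t j) = Some d" using assms(3) by (rule at_port_direction)
  then have "ctl t j \<noteq> Terminate" by auto
  from assms(1,2) this show ?thesis
  proof (cases rule: still_cases)
    case idle
    then show ?thesis using assms(3) inside_not_at_port by blast
  next
    case (wait e)
    then show ?thesis using d by simp
  next
    case (fail e)
    then show ?thesis using d assms(3) by simp
  qed
qed

lemma at_port_forever:
  assumes "still T" "T \<le> t" "at_port t j d" "t \<le> s" shows "at_port s j d \<and> blocked s j d"
  using assms(4)
proof (induction s rule: dec_induct)
  case base
  then show ?case using at_port_stays assms by blast
next
  case (step s)
  then have "at_port (Suc s) j d" "T \<le> Suc s" using at_port_stays[of T s j d] assms by auto
  then show ?case using at_port_stays assms(1) by blast
qed

lemma active_later: "\<exists>s\<ge>t. j \<in> active (ch s)"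
  using semi_sync unfolding semi_synchronous_def INFM_nat_le by blast

text \<open>On a right port \<open>Btime\<close> is positive, so at its next activation the agent
  would change to \<open>Reverse\<close> or terminate.\<close>

lemma still_not_at_Right:
  assumes "still T" "T \<le> t" shows "\<not> at_port t j Right"
proof
  assume R: "at_port t j Right"
  obtain s where s: "s \<ge> t" "j \<in> active (ch s)" using active_later by blast
  have at: "at_port s j Right" using at_port_forever[OF assms R s(1)] ..
  then have b: "ctl s j = Bounce" "Btime (mem (c s) j) > 0" using basic[of s j] by (auto simp: basic_def)
  have "T \<le> s" "ctl s j \<noteq> Terminate" using s assms b by auto
  from assms(1) this show False
    by (cases rule: still_cases) (use s(2) b in auto)
qed

text \<open>Whoever denied the port, by holding it before or by winning the tie, does not move and
  is therefore on it after the round.\<close>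

lemma still_fail:
  assumes T: "still T" "T \<le> t" and d: "\<not> gains_access landmark lam (ch t) (c t) j (port_side d)"
  shows "node (c t) (other_agent j) = node (c t) j" "at_port (Suc t) (other_agent j) d"
    "at_port t (other_agent j) d \<or> \<not> at_port t j d"
proof -
  define k where "k = other_agent j"
  have "node (c t) k = node (c t) j \<and> at_port (Suc t) k d \<and> (at_port t k d \<or> \<not> at_port t j d)"
    using d node_less[of t j]
  proof (cases rule: not_gains_access)
    case 1
    then show ?thesis using at_port_stays[OF T] by (auto simp: k_def)
  next
    case 2
    then obtain m where "plan t k = (m, Some d)" by (cases "plan t k") (auto simp: k_def)
    from this node_less have "at_port (Suc t) k d"
    proof (cases rule: plan_Some)
      case move
      then show ?thesis using T node_neq_towards by (auto simp: still_def)
    next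
      case fail
      then show ?thesis using 2 by (simp add: k_def)
    qed
    then show ?thesis using 2 by (simp add: k_def)
  qed
  then show "node (c t) (other_agent j) = node (c t) j" "at_port (Suc t) (other_agent j) d"
    "at_port t (other_agent j) d \<or> \<not> at_port t j d" by (simp_all add: k_def)
qed

text \<open>When a bouncing agent is active, either it or the agent that denies it access ends the
  round on a right port, which is impossible.\<close>

lemma still_not_Bounce:
  assumes T: "still T" "T \<le> t" shows "ctl t j \<noteq> Bounce"
proof
  assume b: "ctl t j = Bounce"
  obtain s where s: "s \<ge> t" "j \<in> active (ch s)" using active_later by blast
  have Ts: "T \<le> s" "T \<le> Suc s" using s(1) T(2) by auto
  have bs: "ctl s j = Bounce" using still_ctl[OF T s(1)] b by simp
  then have "ctl s j \<noteq> Terminate" by simp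
  from T(1) Ts(1) this show False
  proof (cases rule: still_cases)
    case idle
    then show ?thesis using s(2) by simp
  next
    case (wait d)
    then show ?thesis using bs still_not_at_Right[OF T(1) Ts(2)] by simp
  next
    case (fail d)
    then have "d = Right" using bs by simp
    then show ?thesis
      using still_fail(2)[OF T(1) Ts(1) fail(6)] still_not_at_Right[OF T(1) Ts(2)] by simp
  qed
qed

text \<open>The partner stays on its left port forever. By exclusion the unterminated agent is not
  on that port, nor on the right one, so it is inside and changes state by a catch when it is next
  active.\<close>

lemma still_not_caught:
  assumes T: "still T" "T \<le> t" and nt: "ctl t j \<noteq> Terminate"
    and k: "node (c t) (other_agent j) = node (c t) j" "at_port t (other_agent j) Left"
  shows False
proof -
  obtain s where s: "s \<ge> t" "j \<in> active (ch s)" using active_later by blast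
  have Ts: "T \<le> s" using s(1) T(2) by simp
  have at: "at_port s (other_agent j) Left" using at_port_forever[OF T k(2) s(1)] ..
  have eq: "node (c s) (other_agent j) = node (c s) j" using still_node[OF T s(1)] k(1) by simp
  have "\<not> at_port s j Left" using exclusion[OF eq] at by blast
  moreover have "\<not> at_port s j Right" using still_not_at_Right[OF T(1) Ts] .
  ultimately have "inside s j" by (metis (full_types) direction.exhaust outside_at_port)
  then have c: "caught s j" using at eq by (simp add: caught_def)
  have "ctl s j \<noteq> Terminate" using nt still_ctl[OF T s(1)] by simp
  from T(1) Ts this show False
    by (cases rule: still_cases) (use s(2) c still_not_Bounce[OF T(1) Ts] in auto)
qed

text \<open>At its next activation such an agent tries to go left. A failure would leave the partner
  on the left port of the same node, contrary to \<open>still_not_caught\<close>.\<close>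

lemma still_at_Left:
  assumes T: "still T" "T \<le> t" and nt: "ctl t j \<noteq> Terminate"
  shows "\<exists>s\<ge>t. at_port s j Left"
proof -
  obtain s where s: "s \<ge> t" "j \<in> active (ch s)" using active_later by blast
  have Ts: "T \<le> s" "T \<le> Suc s" using s(1) T(2) by auto
  have nts: "ctl s j \<noteq> Terminate" using nt still_ctl[OF T s(1)] by simp
  have "explore_direction (ctl s j) = Some Left"
    using nts still_not_Bounce[OF T(1) Ts(1), of j] by (cases "ctl s j") auto
  note dir = this
  from T(1) Ts(1) nts show ?thesis
  proof (cases rule: still_cases)
    case idle
    then show ?thesis using s(2) by simp
  next
    case (wait d)
    then have "at_port (Suc s) j Left" using dir by simp
    then show ?thesis using s(1) le_SucI by blast
  next
    case (fail d)
    then have d: "d = Left" using dir by simp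
    note f = still_fail[OF T(1) Ts(1) fail(6)]
    have "node (c (Suc s)) (other_agent j) = node (c (Suc s)) j"
      using f(1) T(1) Ts(1) by (simp add: still_def)
    moreover have "ctl (Suc s) j \<noteq> Terminate" using fail(3) nts by simp
    ultimately have False using still_not_caught[OF T(1) Ts(2)] f(2) d by blast
    then show ?thesis ..
  qed
qed

lemma still_terminal:
  assumes T: "still T" shows "\<exists>j. ctl T j = Terminate"
proof (rule ccontr)
  assume "\<nexists>j. ctl T j = Terminate"
  then have "\<exists>s\<ge>T. at_port s j Left" for j using still_at_Left[OF T order_refl] by simp
  then obtain sA sB where s: "sA \<ge> T" "at_port sA A Left" "sB \<ge> T" "at_port sB B Left" by meson
  define s where "s = max sA sB"
  \<comment> \<open>Both stay on left ports from round \<open>s\<close> on; with a single missing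
    edge these are the same port, against mutual exclusion.\<close>
  have "at_port s A Left \<and> blocked s A Left" "at_port s B Left \<and> blocked s B Left"
    using at_port_forever[OF T s(1,2)] at_port_forever[OF T s(3,4)] by (simp_all add: s_def)
  moreover from this have "node (c s) B = node (c s) A" using blocked_same by blast
  ultimately show False using exclusion[of s A Left] by simp
qed

lemma terminal_forever:
  assumes "ctl T j = Terminate" "T \<le> t"
  shows "ctl t j = Terminate \<and> node (c t) j = node (c T) j"
  using assms(2)
proof (induction t rule: dec_induct)
  case (step t)
  then show ?case using terminal_Suc[OF basic] by simp
qed (use assms(1) in simp)

lemma liveness:
  "\<exists>j. terminates c j \<and> (terminates c (other_agent j) \<or> waits_forever_on_port c (other_agent j))"
proof -
  obtain T where T: "still T" using eventually_still ..
  have terminates: "terminates c j" if "ctl T j = Terminate" for j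
    using terminal_forever[OF that] by (auto simp: terminates_def terminal_def)
  have wait: "waits_forever_on_port c j" if nt: "ctl T j \<noteq> Terminate" for j
  proof -
    obtain s where s: "s \<ge> T" "at_port s j Left" using still_at_Left[OF T order_refl nt] by blast
    have "node (c t) j = node (c s) j \<and> place (c t) j = OnPort (port_side Left)" if "t \<ge> s" for t
      using at_port_forever[OF T s that] still_node[OF T s(1) that] by (simp add: at_port_def)
    then show ?thesis unfolding waits_forever_on_port_def by blast
  qed
  obtain j where "ctl T j = Terminate" using still_terminal[OF T] ..
  then show ?thesis using terminates wait by blast
qed

lemma eventually_explored: "\<exists>T. explored_by n c T"
proof -
  obtain j T where T: "ctl T j = Terminate" using liveness by (auto simp: terminates_def terminal_def)
  \<comment> \<open>The initial state is not terminal, so \<open>T\<close> has a predecessor, by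
    which the ring is explored.\<close>
  have "ctl 0 j = Init" by (simp add: initial init_memory_def)
  with T obtain t where "T = Suc t" by (cases T) auto
  then show ?thesis using terminal_explored T by blast
qed

end

theorem theorem14:
  shows "\<exists>f :: nat \<Rightarrow> real. f \<in> O(\<lambda>n. real n ^ 2) \<and>
    (\<forall>n landmark lam ch c. execution n landmark lam ch c \<and> chirality n lam \<longrightarrow>
       (\<exists>T. explored_by n c T) \<and>
       (\<forall>T. real (traversals c T) \<le> f n) \<and>
       (\<forall>t j. terminal (c (Suc t)) j \<longrightarrow> explored_by n c t) \<and>
       (\<exists>j. terminates c j \<and>
            (terminates c (other_agent j) \<or> waits_forever_on_port c (other_agent j))))"
proof (intro exI[of _ "\<lambda>n. 180 * real n ^ 2"] conjI allI impI)
  show "(\<lambda>n. 180 * real n ^ 2) \<in> O(\<lambda>n. real n ^ 2)" by simp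
next
  fix n landmark :: nat and lam :: "agent \<Rightarrow> orientation" and ch :: "nat \<Rightarrow> choice" and c
  assume "execution n landmark lam ch c \<and> chirality n lam"
  then interpret ring_execution n landmark lam ch c by unfold_locales auto
  show "\<exists>T. explored_by n c T" by (rule eventually_explored)
  show "\<exists>j. terminates c j \<and> (terminates c (other_agent j) \<or> waits_forever_on_port c (other_agent j))"
    by (rule liveness)
  show "explored_by n c t" if "terminal (c (Suc t)) j" for t j
    using terminal_explored that by (simp add: terminal_def)
  show "real (traversals c T) \<le> 180 * real n ^ 2" for T
  proof -
    have "real_of_int (int (traversals c T)) \<le> real_of_int (180 * int n * int n)"
      using traversals_le of_int_le_iff by blast
    then show ?thesis by (simp add: power2_eq_square)
  qed
qed
end
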